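(* Assume the setting and Algorithm SC described in the context, and suppose Assumptions (A1)–(A4) hold. Suppose the step-size sequences satisfy (i) $\sum_{k=1}^{\infty}\alpha_{ij,k}^2<\infty$ and $\sup_{k}\alpha_{ij,k+1}/\alpha_{ij,k}<\infty$ for all $(i,j)\in\mathcal{E}$; (ii) $\sum_{k=1}^{\infty}\beta_{i,k}^2<\infty$ and $\sup_k \beta_{i,k+1}/\beta_{i,k}<\infty$ for all $i\in\mathcal{V}$; (iii) $\sum_{k=1}^{\infty} z_k=\infty$, where $z_k=\min\{\alpha_{ij,k}/k^{\nu_{ij}},\ (i,j)\in\mathcal{E};\ \beta_{i,k},\ i\in\mathcal{V}\}$. Then for every $i\in\mathcal{V}$, $\hat\theta_{i,k}\to\theta$ almost surely as $k\to\infty$.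
   Context: Network: undirected weighted graph with sensor set $\mathcal{V}=\{1,\dots,N\}$, symmetric nonnegative weights $a_{ij}=a_{ji}$, with $a_{ij}>0$ iff $(i,j)\in\mathcal{E}$; the edge set $\mathcal{E}$ is regarded as a set of ordered pairs that is symmetric ($(i,j)\in\mathcal{E}\iff(j,i)\in\mathcal{E}$), $M=|\mathcal{E}|/2$ is the number of undirected edges, and $\mathcal{N}_i=\{j:(i,j)\in\mathcal{E}\}$. The Laplacian is $\mathcal{L}=\mathcal{D}-\mathcal{A}$ with $\mathcal{A}=(a_{ij})$, $\mathcal{D}=\mathrm{diag}(\sum_{j\in\mathcal{N}_i}a_{ij})$; $\lambda_2(\mathcal{L})$ is its second smallest eigenvalue. Observations: unknown $\theta\in\mathbb{R}^n$; sensor $i$ observes $y_{i,k}=H_{i,k}\theta+w_{i,k}$, $k\ge1$, with deterministic $H_{i,k}\in\mathbb{R}^{m_i\times n}$ and noise $w_{i,k}\in\mathbb{R}^{m_i}$. Let $d_{i,k}$ ($i\in\mathcal{V},k\ge1$) be the dithering noises used below, $\mathcal{F}_k=\sigma(w_{i,t},d_{i,t}: i\in\mathcal{V},1\le t\le k)$ and $\mathcal{F}^w_k=\sigma(w_{i,t}: i\in\mathcal{V},1\le t\le k)$. Assumptions. (A1) There is $\bar H>0$ with $\|H_{i,k}\|\le\bar H$ for all $i,k$, and there are a positive integer $p$ and $\delta>0$ with $\frac1p\sum_{t=k}^{k+p-1}\sum_{i=1}^N H_{i,t}^\top H_{i,t}\ge\delta I_n$ for all $k\ge1$. (A2) $\{w_{i,k},\mathcal{F}_k\}$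 is a martingale difference sequence and $\sup_{i,k}\mathbb{E}[\|w_{i,k}\|^\rho\mid\mathcal{F}^w_{k-1}]<\infty$ a.s. for some $\rho>2$. (A3) The graph is connected, i.e. $\mathrm{rank}(\mathcal{L})=N-1$. (A4) The $d_{i,k}$ are i.i.d. with the Laplace distribution $\mathrm{Lap}(0,1)$ (density $f(x)=\frac12e^{-|x|}$, distribution function $F$), mutually independent over all $(i,k)$, and independent of all $w_{j,t}$. Algorithm SC. Inputs: deterministic initial estimates $\hat\theta_{i,0}\in\mathbb{R}^n$; event-triggered coefficients $\nu_{ij}=\nu_{ji}\ge0$; noise coefficients $b_{ij}=b_{ji}>0$; step sizes $\alpha_{ij,k}=\alpha_{ji,k}>0$ ($(i,j)\in\mathcal{E}$) and $\beta_{i,k}>0$. For $k=1,2,\dots$: let $\varphi_k\in\mathbb{R}^n$ be the $l$-th standard basis vector, where $k=nq+l$ with $q\in\mathbb{N}\cup\{0\}$, $l\in\{1,\dots,n\}$; set $x_{i,k}=\varphi_k^\top\hat\theta_{i,k-1}$; set $C_{ij,k}=\nu_{ij}b_{ij}\ln k$; set $s_{ij,k}=1$ if $x_{i,k}+b_{ij}d_{i,k}>0$ and $s_{ij,k}=-1$ otherwise. Sensor $i$ sends the one-bit message $s_{ij,k}$ to neighbor $j$ iff $|x_{i,k}+b_{ij}d_{i,k}|>C_{ij,k}$; sensor $i$ sets $\hat s_{ji,k}=s_{ji,k}$ if it received $s_{ji,k}$ from $j$, and $\hat s_{ji,k}=0$ otherwise. With $G_{ij,k}(x)=F((x-C_{ij,k})/b_{ij})-F((-x-C_{ij,k})/b_{ij})$,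 update $\check\theta_{i,k}=\hat\theta_{i,k-1}+\varphi_k\sum_{j\in\mathcal{N}_i}\alpha_{ij,k}a_{ij}(\hat s_{ji,k}-G_{ij,k}(x_{i,k}))$, $\hat\theta_{i,k}=\check\theta_{i,k}+\beta_{i,k}H_{i,k}^\top(y_{i,k}-H_{i,k}\hat\theta_{i,k-1})$. Write $\tilde\theta_{i,k}=\hat\theta_{i,k}-\theta$. *)

theory Defs
  imports "HOL-Probability.Probability" "Jordan_Normal_Form.Matrix"
begin

text \<open>Euclidean norm of a vector of type real vec.\<close>
definition vnorm :: "real vec \<Rightarrow> real" where
  "vnorm v = sqrt (v \<bullet> v)"

text \<open>Sensor set V = {1..N}; edge set E; neighbour set N_i.\<close>
definition edges :: "nat \<Rightarrow> (nat \<Rightarrow> nat \<Rightarrow> real) \<Rightarrow> (nat \<times> nat) set" where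
  "edges N a = {(i, j). i \<in> {1..N} \<and> j \<in> {1..N} \<and> 0 < a i j}"

definition nbrs :: "nat \<Rightarrow> (nat \<Rightarrow> nat \<Rightarrow> real) \<Rightarrow> nat \<Rightarrow> nat set" where
  "nbrs N a i = {j. (i, j) \<in> edges N a}"

text \<open>Connectedness of the undirected graph: any two sensors are joined by a path.\<close>
definition graph_connected :: "nat \<Rightarrow> (nat \<Rightarrow> nat \<Rightarrow> real) \<Rightarrow> bool" where
  "graph_connected N a \<longleftrightarrow> (\<forall>i\<in>{1..N}. \<forall>j\<in>{1..N}. (i, j) \<in> (edges N a)\<^sup>*)"

text \<open>Distribution function of Lap(0,1).\<close>
definition lap_cdf :: "real \<Rightarrow> real" where
  "lap_cdf x = (if x < 0 then exp x / 2 else 1 - exp (- x) / 2)"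

text \<open>Sigma-algebra on the space of M generated by a set of real random variables.\<close>
definition sigma_fun :: "'a measure \<Rightarrow> ('a \<Rightarrow> real) set \<Rightarrow> 'a measure" where
  "sigma_fun M S = sigma (space M) {f -` A \<inter> space M | f A. f \<in> S \<and> A \<in> sets borel}"

text \<open>Threshold C_{ij,k} and the function G_{ij,k}.\<close>
definition thr :: "(nat \<Rightarrow> nat \<Rightarrow> real) \<Rightarrow> (nat \<Rightarrow> nat \<Rightarrow> real) \<Rightarrow> nat \<Rightarrow> nat \<Rightarrow> nat \<Rightarrow> real" where
  "thr \<nu> b i j k = \<nu> i j * b i j * ln (real k)"

definition Gfun :: "(nat \<Rightarrow> nat \<Rightarrow> real) \<Rightarrow> (nat \<Rightarrow> nat \<Rightarrow> real) \<Rightarrow> nat \<Rightarrow> nat \<Rightarrow> nat \<Rightarrow> real \<Rightarrow> real" where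
  "Gfun \<nu> b i j k x = lap_cdf ((x - thr \<nu> b i j k) / b i j) - lap_cdf ((- x - thr \<nu> b i j k) / b i j)"

text \<open>Regressor phi_k: the l-th standard basis vector where k = n q + l, l in {1..n};
  in 0-based indexing this is index (k - 1) mod n.\<close>
definition phi :: "nat \<Rightarrow> nat \<Rightarrow> real vec" where
  "phi n k = unit_vec n ((k - 1) mod n)"

text \<open>Received message \<open>\<hat>s_{ji,k}\<close> at sensor i from neighbour j, given x_{j,k} and d_{j,k}.\<close>
definition recv :: "(nat \<Rightarrow> nat \<Rightarrow> real) \<Rightarrow> (nat \<Rightarrow> nat \<Rightarrow> real) \<Rightarrow> nat \<Rightarrow> nat \<Rightarrow> nat \<Rightarrow> real \<Rightarrow> real \<Rightarrow> real" where
  "recv \<nu> b j i k xj dj =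
     (if \<bar>xj + b j i * dj\<bar> > thr \<nu> b j i k
      then (if xj + b j i * dj > 0 then 1 else -1) else 0)"

text \<open>Algorithm SC. Given realisations d (dithers) and y (observations), returns the
  estimates: sc_est ... k i = \<open>\<hat>\<theta>_{i,k}\<close>.\<close>
primrec sc_est ::
  "nat \<Rightarrow> nat \<Rightarrow> (nat \<Rightarrow> nat \<Rightarrow> real) \<Rightarrow> (nat \<Rightarrow> nat \<Rightarrow> real) \<Rightarrow> (nat \<Rightarrow> nat \<Rightarrow> real)
   \<Rightarrow> (nat \<Rightarrow> nat \<Rightarrow> nat \<Rightarrow> real) \<Rightarrow> (nat \<Rightarrow> nat \<Rightarrow> real) \<Rightarrow> (nat \<Rightarrow> nat \<Rightarrow> real mat)
   \<Rightarrow> (nat \<Rightarrow> real vec) \<Rightarrow> (nat \<Rightarrow> nat \<Rightarrow> real) \<Rightarrow> (nat \<Rightarrow> nat \<Rightarrow> real vec)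
   \<Rightarrow> nat \<Rightarrow> nat \<Rightarrow> real vec" where
  "sc_est n N a \<nu> b \<alpha> \<beta> H \<theta>0 d y 0 = \<theta>0"
| "sc_est n N a \<nu> b \<alpha> \<beta> H \<theta>0 d y (Suc k') =
    (let k = Suc k';
         prev = sc_est n N a \<nu> b \<alpha> \<beta> H \<theta>0 d y k';
         x = (\<lambda>j. phi n k \<bullet> prev j)
     in (\<lambda>i.
       let chk = prev i + (\<Sum>j\<in>nbrs N a i.
                     \<alpha> i j k * a i j * (recv \<nu> b j i k (x j) (d j k) - Gfun \<nu> b i j k (x i))) \<cdot>\<^sub>v phi n k
       in chk + \<beta> i k \<cdot>\<^sub>v (transpose_mat (H i k) *\<^sub>v (y i k - H i k *\<^sub>v prev i))))"

end

theory Submission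
  imports Defs
begin

text \<open>
  Let \<open>e\<close> be the vector of estimation errors and \<open>V\<close> its squared norm, summed over the sensors.
  Since \<open>G\<close> is increasing and the weights are symmetric, one step of the algorithm gives
  \<open>V' \<le> V - D + M + A (1 + V)\<close>, where \<open>D \<ge> 0\<close> collects consensus and observation errors,
  \<open>M\<close> is a martingale difference linear in \<open>e\<close>, and \<open>A \<ge> 0\<close> is almost surely summable.
  For \<open>ln (1 + V)\<close> the noise becomes \<open>M / (1 + V)\<close>, which has summable second moments without any
  a priori bound on \<open>e\<close>; so its series converges almost surely, and then, path by path, \<open>V\<close>
  converges and \<open>D\<close> is summable.

  On a bounded path the slope of \<open>G\<close> is at least of order \<open>k powr (-\<nu>)\<close>, so \<open>D\<close> dominates \<open>z\<close> times
  a quadratic form in \<open>e\<close>. Connectedness and persistent excitation make the sum of these forms over a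
  window of bounded length comparable to \<open>V\<close>. As \<open>z\<close> is not summable and grows by at most a
  constant factor per step, \<open>V\<close> must tend to \<open>0\<close>.
\<close>

section \<open>Series of square integrable martingale differences\<close>

text \<open>The message from \<open>j\<close> is compared with \<open>G\<close> at the receiver's
  value \<open>x_i\<close>, so it is not centred. Writing
  \<open>s - G(x_i) = (s - G(x_j)) + (G(x_j) - G(x_i))\<close> separates two roles: the dither is
  independent of the past, hence the first part has conditional mean \<open>0\<close> and goes into
  \<open>M\<close>; the second part, counted from both ends of an edge, gives the consensus part of
  \<open>D\<close>. The threshold is \<open>b\<close> times \<open>\<nu> ln k\<close>, and a Laplace
  density at distance \<open>\<nu> ln k\<close> is of order \<open>k powr (-\<nu>)\<close>; this is
  the origin of the powers in \<open>z\<close>. Two obstacles shape the argument. The conditional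
  moments of the observation noise have only a random bound, so no bound on the expectation of
  \<open>V\<close> is at hand, and everything after the convergence of the noise series is done on a
  fixed path. Moreover, one step sees one coordinate and one set of observation matrices, so
  \<open>D\<close> at a single time does not control \<open>V\<close>. The window inequality
  therefore evaluates the quadratic forms at a frozen error, and the drift of the error over the
  window has to be shown to vanish.\<close>

lemma abs_le_one_plus_square: "\<bar>t\<bar> \<le> 1 + (t::real)\<^sup>2"
  using self_le_power[of "\<bar>t\<bar>" 2] zero_le_power2[of t] unfolding power2_abs by linarith

lemma (in finite_measure) integrable_of_integrable_power2:
  fixes X :: "'a \<Rightarrow> real"
  assumes [measurable]: "X \<in> borel_measurable M" and "integrable M (\<lambda>x. (X x)\<^sup>2)"
  shows "integrable M X"
proof (rule Bochner_Integration.integrable_bound)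
  show "integrable M (\<lambda>x. 1 + (X x)\<^sup>2)" using assms by auto
  show "AE x in M. norm (X x) \<le> norm (1 + (X x)\<^sup>2)" using abs_le_one_plus_square by simp
qed simp

text \<open>The martingale difference property is expressed by testing against bounded
  \<open>F k\<close>-measurable functions. Both sources of noise deliver it in this form: the
  dithers through independence, the observation noise through its conditional expectation.
  \<open>F k\<close> is the information before the increment \<open>X k\<close>, which is known at
  time \<open>Suc k\<close>.\<close>

locale square_integrable_martingale_differences = prob_space M
  for M :: "'a measure" +
  fixes F :: "nat \<Rightarrow> 'a measure" and X :: "nat \<Rightarrow> 'a \<Rightarrow> real"
  assumes subalg: "\<And>k. subalgebra M (F k)"
    and filtration: "\<And>k. subalgebra (F (Suc k)) (F k)"
    and adapted: "\<And>k. X k \<in> borel_measurable (F (Suc k))"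
    and integrable_power2: "\<And>k. integrable M (\<lambda>x. (X k x)\<^sup>2)"
    and orthogonal: "\<And>k h B. h \<in> borel_measurable (F k) \<Longrightarrow> (\<And>x. \<bar>h x\<bar> \<le> B)
      \<Longrightarrow> (\<integral>x. h x * X k x \<partial>M) = 0"
begin

lemma shift: "square_integrable_martingale_differences M (\<lambda>k. F (m + k)) (\<lambda>k. X (m + k))"
proof
  show "(\<integral>x. h x * X (m + k) x \<partial>M) = 0"
    if "h \<in> borel_measurable (F (m + k))" "\<And>x. \<bar>h x\<bar> \<le> B" for k h B
    using orthogonal that by blast
qed (use subalg filtration adapted integrable_power2 in simp_all)

lemma random_variable_X [measurable]: "X k \<in> borel_measurable M"
  using measurable_from_subalg[OF subalg adapted] .

text \<open>Freezing the partial sums at their exit from \<open>(-l, l)\<close> turns a bound on their maximum into a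
  bound on the terminal value.\<close>

primrec frozen_sum :: "real \<Rightarrow> nat \<Rightarrow> 'a \<Rightarrow> real" where
  "frozen_sum l 0 = (\<lambda>x. 0)"
| "frozen_sum l (Suc k) = (\<lambda>x. frozen_sum l k x + (if \<bar>frozen_sum l k x\<bar> < l then X k x else 0))"

lemma frozen_sum_adapted: "frozen_sum l k \<in> borel_measurable (F k)"
proof (induction k)
  case (Suc k)
  have [measurable]: "frozen_sum l k \<in> borel_measurable (F (Suc k))" "X k \<in> borel_measurable (F (Suc k))"
    using measurable_from_subalg[OF filtration Suc] adapted by auto
  show ?case by simp
qed simp

lemma frozen_sum_measurable [measurable]: "frozen_sum l k \<in> borel_measurable M"
  using measurable_from_subalg[OF subalg frozen_sum_adapted] .

lemma frozen_sum_second_moment: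
  assumes "0 < l"
  shows "integrable M (\<lambda>x. (frozen_sum l k x)\<^sup>2)
    \<and> (\<integral>x. (frozen_sum l k x)\<^sup>2 \<partial>M) \<le> (\<Sum>j<k. \<integral>x. (X j x)\<^sup>2 \<partial>M)"
proof (induction k)
  case (Suc k)
  let ?T = "frozen_sum l k"
  define h where "h = (\<lambda>x. if \<bar>?T x\<bar> < l then ?T x else 0)"
  define g where "g = (\<lambda>x. (if \<bar>?T x\<bar> < l then 1 else 0) * (X k x)\<^sup>2)"
  have [measurable]: "?T \<in> borel_measurable (F k)" by (rule frozen_sum_adapted)
  have hF: "h \<in> borel_measurable (F k)" unfolding h_def by measurable
  then have [measurable]: "h \<in> borel_measurable M" by (rule measurable_from_subalg[OF subalg])
  have hb: "\<bar>h x\<bar> \<le> l" for x using assms by (auto simp: h_def)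
  have iX: "integrable M (X k)"
    by (rule integrable_of_integrable_power2[OF _ integrable_power2]) simp
  have ihX: "integrable M (\<lambda>x. h x * X k x)"
    by (rule Bochner_Integration.integrable_bound[where f="\<lambda>x. l * X k x"])
      (use iX hb assms in \<open>auto simp: abs_mult intro!: mult_right_mono\<close>)
  have ig: "integrable M g"
    unfolding g_def by (rule Bochner_Integration.integrable_bound[OF integrable_power2[of k]]) auto
  have eq: "(frozen_sum l (Suc k) x)\<^sup>2 = (?T x)\<^sup>2 + 2 * (h x * X k x) + g x" for x
    by (auto simp: h_def g_def power2_eq_square algebra_simps)
  have "(\<integral>x. g x \<partial>M) \<le> (\<integral>x. (X k x)\<^sup>2 \<partial>M)"
    by (rule integral_mono[OF ig integrable_power2]) (auto simp: g_def)
  moreover have "(\<integral>x. (?T x)\<^sup>2 + 2 * (h x * X k x) + g x \<partial>M)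
      = (\<integral>x. (?T x)\<^sup>2 \<partial>M) + 2 * (\<integral>x. h x * X k x \<partial>M) + (\<integral>x. g x \<partial>M)"
    using Suc ihX ig by simp
  ultimately show ?case
    using Suc ihX ig orthogonal[OF hF hb] unfolding eq by auto
qed simp

lemma frozen_sum_cases:
  "l \<le> \<bar>frozen_sum l n x\<bar> \<or> (frozen_sum l n x = (\<Sum>j<n. X j x) \<and> (\<forall>k\<le>n. \<bar>\<Sum>j<k. X j x\<bar> < l))"
  if "0 < l"
proof (induction n)
  case (Suc n)
  then show ?case by (auto simp: le_Suc_eq)
qed (use that in auto)

lemma maximal_inequality:
  assumes "0 < l"
  shows "prob {x \<in> space M. \<exists>k\<le>n. l \<le> \<bar>\<Sum>j<k. X j x\<bar>} \<le> (\<Sum>j<n. \<integral>x. (X j x)\<^sup>2 \<partial>M) / l\<^sup>2"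
proof -
  have "prob {x \<in> space M. \<exists>k\<le>n. l \<le> \<bar>\<Sum>j<k. X j x\<bar>} \<le> prob {x \<in> space M. l\<^sup>2 \<le> (frozen_sum l n x)\<^sup>2}"
  proof (rule finite_measure_mono)
    show "{x \<in> space M. \<exists>k\<le>n. l \<le> \<bar>\<Sum>j<k. X j x\<bar>} \<subseteq> {x \<in> space M. l\<^sup>2 \<le> (frozen_sum l n x)\<^sup>2}"
    proof safe
      fix x k assume "k \<le> n" "l \<le> \<bar>\<Sum>j<k. X j x\<bar>"
      then have "l \<le> \<bar>frozen_sum l n x\<bar>" using frozen_sum_cases[OF assms, of n x] by (meson not_le)
      then show "l\<^sup>2 \<le> (frozen_sum l n x)\<^sup>2" using assms abs_le_square_iff[of l "frozen_sum l n x"] by simp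
    qed
  qed measurable
  also have "\<dots> \<le> (\<integral>x. (frozen_sum l n x)\<^sup>2 \<partial>M) / l\<^sup>2"
    using assms frozen_sum_second_moment[OF assms, of n]
    by (intro integral_Markov_inequality_measure[where A="space M"]) auto
  also have "\<dots> \<le> (\<Sum>j<n. \<integral>x. (X j x)\<^sup>2 \<partial>M) / l\<^sup>2"
    using frozen_sum_second_moment[OF assms, of n] by (intro divide_right_mono) auto
  finally show ?thesis .
qed

lemma maximal_inequality_infinite:
  assumes "0 < l" and s: "summable (\<lambda>j. \<integral>x. (X j x)\<^sup>2 \<partial>M)"
  shows "prob {x \<in> space M. \<exists>k. l \<le> \<bar>\<Sum>j<k. X j x\<bar>} \<le> (\<Sum>j. \<integral>x. (X j x)\<^sup>2 \<partial>M) / l\<^sup>2"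
proof -
  define A where "A n = {x \<in> space M. \<exists>k\<le>n. l \<le> \<bar>\<Sum>j<k. X j x\<bar>}" for n
  have [measurable]: "A n \<in> sets M" for n unfolding A_def by measurable
  have "(\<lambda>n. prob (A n)) \<longlonglongrightarrow> prob (\<Union>n. A n)"
    by (rule finite_Lim_measure_incseq) (auto simp: A_def incseq_def intro: order_trans)
  moreover have "prob (A n) \<le> (\<Sum>j. \<integral>x. (X j x)\<^sup>2 \<partial>M) / l\<^sup>2" for n
  proof -
    have "prob (A n) \<le> (\<Sum>j<n. \<integral>x. (X j x)\<^sup>2 \<partial>M) / l\<^sup>2"
      unfolding A_def by (rule maximal_inequality[OF assms(1)])
    also have "\<dots> \<le> (\<Sum>j. \<integral>x. (X j x)\<^sup>2 \<partial>M) / l\<^sup>2"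
      by (intro divide_right_mono sum_le_suminf s) auto
    finally show ?thesis .
  qed
  ultimately have "prob (\<Union>n. A n) \<le> (\<Sum>j. \<integral>x. (X j x)\<^sup>2 \<partial>M) / l\<^sup>2"
    by (intro LIMSEQ_le_const2) auto
  moreover have "(\<Union>n. A n) = {x \<in> space M. \<exists>k. l \<le> \<bar>\<Sum>j<k. X j x\<bar>}" by (auto simp: A_def)
  ultimately show ?thesis by simp
qed

text \<open>The partial sums started at \<open>m\<close> leave \<open>(-l, l)\<close> with
  probability at most a tail of the variance series divided by the square of \<open>l\<close>. The
  exceptional event \<open>B\<close> of level \<open>l\<close> lies in all these events, hence is
  null. Letting \<open>l\<close> run through a sequence tending to \<open>0\<close> yields the
  Cauchy criterion on each remaining path.\<close>

theorem AE_summable: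
  assumes s: "summable (\<lambda>j. \<integral>x. (X j x)\<^sup>2 \<partial>M)"
  shows "AE x in M. summable (\<lambda>j. X j x)"
proof -
  define v where "v j = (\<integral>x. (X j x)\<^sup>2 \<partial>M)" for j
  have v: "summable v" unfolding v_def using s .
  have "AE x in M. \<exists>m. \<forall>k. \<bar>\<Sum>j<k. X (m + j) x\<bar> < l" if l: "0 < l" for l
  proof -
    define A where "A m = {x \<in> space M. \<exists>k. l \<le> \<bar>\<Sum>j<k. X (m + j) x\<bar>}" for m
    define B where "B = (\<Inter>m. A m)"
    have [measurable]: "A m \<in> sets M" for m unfolding A_def by measurable
    have [measurable]: "B \<in> sets M" unfolding B_def by measurable
    have "prob B \<le> (\<Sum>j. v (m + j)) / l\<^sup>2" for m
    proof -
      interpret S: square_integrable_martingale_differences M "\<lambda>k. F (m + k)" "\<lambda>k. X (m + k)"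
        by (rule shift)
      have "prob B \<le> prob (A m)" by (rule finite_measure_mono) (auto simp: B_def)
      also have "\<dots> \<le> (\<Sum>j. v (m + j)) / l\<^sup>2"
        unfolding A_def v_def
        by (rule S.maximal_inequality_infinite[OF l])
          (use summable_iff_shift[of v m] v in \<open>simp add: v_def add.commute\<close>)
      finally show ?thesis .
    qed
    moreover have "(\<lambda>m. (\<Sum>j. v (m + j)) / l\<^sup>2) \<longlonglongrightarrow> 0 / l\<^sup>2"
      by (intro tendsto_divide tendsto_const) (use suminf_exist_split2[OF v] l in \<open>auto simp: add.commute\<close>)
    ultimately have "prob B \<le> 0"
      by (intro LIMSEQ_le_const) auto
    then have "prob B = 0" by (simp add: measure_le_0_iff)
    then have "B \<in> null_sets M" by (auto simp: null_sets_def emeasure_eq_measure)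
    then show ?thesis
      by (rule AE_I'[rotated 0]) (force simp: B_def A_def not_less)
  qed
  then have "AE x in M. \<forall>r::nat. \<exists>m. \<forall>k. \<bar>\<Sum>j<k. X (m + j) x\<bar> < inverse (real (Suc r))"
    by (simp add: AE_all_countable)
  then show ?thesis
  proof eventually_elim
    case (elim x)
    show ?case
      unfolding summable_Cauchy
    proof (intro allI impI)
      fix e :: real assume "0 < e"
      \<comment> \<open>Half of \<open>e\<close>, because a block from \<open>p\<close> to
        \<open>q\<close> is the difference of two partial sums that both start at
        \<open>m\<close>.\<close>
      then obtain r where r: "inverse (real (Suc r)) < e / 2" using reals_Archimedean[of "e/2"] by auto
      obtain m where m: "\<And>k. \<bar>\<Sum>j<k. X (m + j) x\<bar> < e / 2" using elim r by (meson less_trans)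
      show "\<exists>N. \<forall>p\<ge>N. \<forall>q. norm (\<Sum>j=p..<q. X j x) < e"
      proof (intro exI[of _ m] allI impI)
        fix p q assume p: "m \<le> p"
        show "norm (\<Sum>j=p..<q. X j x) < e"
        proof (cases "p \<le> q")
          case True
          have eq: "(\<Sum>j=m..<t. X j x) = (\<Sum>j<t-m. X (m + j) x)" if "m \<le> t" for t
            using sum.shift_bounds_nat_ivl[of "\<lambda>j. X j x" 0 m "t-m"] that
            by (simp add: add.commute lessThan_atLeast0)
          have "(\<Sum>j=p..<q. X j x) = (\<Sum>j=m..<q. X j x) - (\<Sum>j=m..<p. X j x)"
            using sum.atLeastLessThan_concat[OF p True, of "\<lambda>j. X j x"] by simp
          then have "(\<Sum>j=p..<q. X j x) = (\<Sum>j<q-m. X (m + j) x) - (\<Sum>j<p-m. X (m + j) x)"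
            using eq[of p] eq[of q] p True by simp
          then show ?thesis unfolding real_norm_def using m[of "q-m"] m[of "p-m"] by linarith
        qed (use \<open>0 < e\<close> in simp)
      qed
    qed
  qed
qed

end

section \<open>The Laplace distribution and the dithered messages\<close>

text \<open>The two branches share the one-sided slope \<open>1/2\<close> at \<open>0\<close>, so
  the piecewise formula is differentiable everywhere and the mean value theorem can be used across
  \<open>0\<close>.\<close>

lemma DERIV_lap_cdf: "(lap_cdf has_real_derivative exp (- \<bar>x\<bar>) / 2) (at x)"
proof -
  have neg: "((\<lambda>x. exp x / 2) has_real_derivative exp x / 2) (at x)" for x :: real
    by (auto intro!: derivative_eq_intros)
  have pos: "((\<lambda>x. 1 - exp (- x) / 2) has_real_derivative exp (- x) / 2) (at x)" for x :: real
    by (auto intro!: derivative_eq_intros)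
  consider "x < 0" | "0 < x" | "x = 0" by linarith
  then show ?thesis
  proof cases
    case 1
    then have "(lap_cdf has_real_derivative exp x / 2) (at x)"
      by (intro has_field_derivative_transform_within_open[OF neg, of "{..<0}"]) (auto simp: lap_cdf_def)
    then show ?thesis using 1 by simp
  next
    case 2
    then have "(lap_cdf has_real_derivative exp (- x) / 2) (at x)"
      by (intro has_field_derivative_transform_within_open[OF pos, of "{0<..}"]) (auto simp: lap_cdf_def)
    then show ?thesis using 2 by simp
  next
    case 3
    have "((\<lambda>y. (lap_cdf y - lap_cdf 0) / (y - 0)) \<longlongrightarrow> 1/2) (at 0)"
    proof (rule filterlim_split_at_real)
      have "((\<lambda>y. (exp y / 2 - 1/2) / (y - 0)) \<longlongrightarrow> 1/2) (at_left (0::real))"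
        using neg[of 0] by (auto simp: has_field_derivative_iff intro: filterlim_mono[OF _ order_refl at_le])
      then show "((\<lambda>y. (lap_cdf y - lap_cdf 0) / (y - 0)) \<longlongrightarrow> 1/2) (at_left 0)"
        by (rule Lim_transform_eventually) (auto simp: eventually_at_filter lap_cdf_def)
      have "((\<lambda>y. (1 - exp (- y) / 2 - 1/2) / (y - 0)) \<longlongrightarrow> 1/2) (at_right (0::real))"
        using pos[of 0] by (auto simp: has_field_derivative_iff intro: filterlim_mono[OF _ order_refl at_le])
      then show "((\<lambda>y. (lap_cdf y - lap_cdf 0) / (y - 0)) \<longlongrightarrow> 1/2) (at_right 0)"
        by (rule Lim_transform_eventually) (auto simp: eventually_at_filter lap_cdf_def)
    qed
    then show ?thesis using 3 by (simp add: has_field_derivative_iff)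
  qed
qed

lemma lap_cdf_minus: "lap_cdf (- x) = 1 - lap_cdf x"
  by (auto simp: lap_cdf_def)

lemma lap_cdf_bounds: "0 \<le> lap_cdf x" "lap_cdf x \<le> 1"
  by (auto simp: lap_cdf_def) (smt (verit) exp_ge_zero exp_le_one_iff)+

text \<open>Mean value theorem: on \<open>[-T, T]\<close> the density is at least
  \<open>exp (- T) / 2\<close>.\<close>

lemma lap_cdf_increment:
  assumes "v \<le> u" "\<bar>u\<bar> \<le> T" "\<bar>v\<bar> \<le> T"
  shows "(u - v) * (exp (- T) / 2) \<le> lap_cdf u - lap_cdf v"
proof (cases "v = u")
  case False
  then obtain t where t: "v < t" "t < u" "lap_cdf u - lap_cdf v = (u - v) * (exp (- \<bar>t\<bar>) / 2)"
    using MVT2[of v u lap_cdf "\<lambda>x. exp (- \<bar>x\<bar>) / 2"] DERIV_lap_cdf assms by auto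
  then have "exp (- T) \<le> exp (- \<bar>t\<bar>)" using assms by auto
  then show ?thesis unfolding t(3) using assms by (intro mult_left_mono) auto
qed simp

lemma lap_cdf_mono: "v \<le> u \<Longrightarrow> lap_cdf v \<le> lap_cdf u"
  using lap_cdf_increment[of v u "max \<bar>u\<bar> \<bar>v\<bar>"]
  by (smt (verit, best) mult_nonneg_nonneg divide_nonneg_nonneg exp_ge_zero max.cobounded1 max.cobounded2)

lemma lap_cdf_measurable [measurable]: "lap_cdf \<in> borel_measurable borel"
  unfolding lap_cdf_def by measurable

lemma nn_integral_laplace_tail:
  "(\<integral>\<^sup>+x. ennreal (exp (- \<bar>x\<bar>) / 2) * indicator {t..} x \<partial>lborel) = ennreal (1 - lap_cdf t)"
proof (rule nn_integral_FTC_atLeast[where F=lap_cdf])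
  have "((\<lambda>x::real. 1 - exp (- x) / 2) \<longlongrightarrow> 1 - 0 / 2) at_top"
    by (intro tendsto_intros) (auto intro: filterlim_compose[OF exp_at_bot] filterlim_uminus_at_bot_at_top)
  then have "((\<lambda>x::real. 1 - exp (- x) / 2) \<longlongrightarrow> 1) at_top" by simp
  then show "(lap_cdf \<longlongrightarrow> 1) at_top"
    by (rule Lim_transform_eventually) (auto simp: lap_cdf_def eventually_at_top_linorder intro!: exI[of _ 0])
qed (auto intro: DERIV_lap_cdf)

context prob_space
begin

text \<open>The law has a density, so the endpoint carries no mass; the left half-line is the
  complement of a closed right one. The open half-lines are the events on which a message is
  triggered.\<close>

lemma laplace_measure_halfline:
  assumes "distributed M lborel D (\<lambda>x. ennreal (exp (- \<bar>x\<bar>) / 2))"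
  shows "measure (distr M borel D) {t..} = 1 - lap_cdf t"
    and "measure (distr M borel D) {t<..} = 1 - lap_cdf t"
    and "measure (distr M borel D) {..<t} = lap_cdf t"
proof -
  have D: "distr M borel D = density lborel (\<lambda>x. ennreal (exp (- \<bar>x\<bar>) / 2))"
    using distributed_distr_eq_density[OF assms] by (metis distr_cong sets_lborel)
  have [measurable]: "D \<in> borel_measurable M" using distributed_measurable[OF assms] by simp
  interpret D: prob_space "distr M borel D" by (rule prob_space_distr) simp
  show ge: "measure (distr M borel D) {t..} = 1 - lap_cdf t"
    unfolding measure_def unfolding D
    using lap_cdf_bounds[of t] by (simp add: emeasure_density nn_integral_laplace_tail)
  have "emeasure (distr M borel D) {t<..} = emeasure (distr M borel D) {t..}"
  proof (rule emeasure_eq_AE)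
    have "AE x in lborel. x \<noteq> t" by (rule AE_lborel_singleton)
    then show "AE x in distr M borel D. (x \<in> {t<..}) = (x \<in> {t..})"
      unfolding D by (subst AE_density) (auto elim!: eventually_mono)
  qed auto
  then show "measure (distr M borel D) {t<..} = 1 - lap_cdf t"
    using ge by (simp add: measure_def)
  have "{..<t} = space (distr M borel D) - {t..}" by auto
  then show "measure (distr M borel D) {..<t} = lap_cdf t"
    using D.prob_compl[of "{t..}"] ge by simp
qed

end

section \<open>Messages as half-line events of the dither, and their mean\<close>

lemma recv_eq:
  assumes "0 < b j i" "0 \<le> thr \<nu> b j i k"
  shows "recv \<nu> b j i k x d = indicator {(thr \<nu> b j i k - x) / b j i<..} d - indicator {..<(- x - thr \<nu> b j i k) / b j i} d"
  using assms by (auto simp: recv_def field_simps split: split_indicator)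

lemma abs_recv_le: "\<bar>recv \<nu> b j i k x d\<bar> \<le> 1"
  by (auto simp: recv_def)

lemma abs_Gfun_le: "\<bar>Gfun \<nu> b i j k x\<bar> \<le> 1"
  unfolding Gfun_def by (smt (verit) lap_cdf_bounds)

lemma recv_measurable [measurable]: "case_prod (recv \<nu> b j i k) \<in> borel_measurable (borel \<Otimes>\<^sub>M borel)"
  unfolding recv_def by measurable

lemma Gfun_measurable [measurable]: "Gfun \<nu> b i j k \<in> borel_measurable borel"
  unfolding Gfun_def by measurable

lemma thr_nonneg: "0 \<le> \<nu> i j \<Longrightarrow> 0 \<le> b i j \<Longrightarrow> 0 \<le> thr \<nu> b i j (Suc k)"
  unfolding thr_def by (auto intro!: mult_nonneg_nonneg)

text \<open>The symmetry of the Laplace law turns the right tail into the first term of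
  \<open>Gfun\<close>. Thus \<open>Gfun\<close> at the sender's value \<open>x\<close> is the mean
  of the message, with coefficients in the order sender \<open>j\<close>, receiver
  \<open>i\<close>.\<close>

lemma (in prob_space) integral_recv:
  assumes "distributed M lborel D (\<lambda>x. ennreal (exp (- \<bar>x\<bar>) / 2))"
    and b: "0 < b j i" and thr: "0 \<le> thr \<nu> b j i k"
  shows "(\<integral>y. recv \<nu> b j i k x y \<partial>distr M borel D) = Gfun \<nu> b j i k x"
proof -
  have [measurable]: "D \<in> borel_measurable M" using distributed_measurable[OF assms(1)] by simp
  interpret D: prob_space "distr M borel D" by (rule prob_space_distr) simp
  have "(\<integral>y. recv \<nu> b j i k x y \<partial>distr M borel D)
      = measure (distr M borel D) {(thr \<nu> b j i k - x) / b j i<..}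
      - measure (distr M borel D) {..<(- x - thr \<nu> b j i k) / b j i}"
    unfolding recv_eq[of b j i, OF b thr] by (subst Bochner_Integration.integral_diff) (auto simp: D.emeasure_eq_measure)
  also have "\<dots> = 1 - lap_cdf (- ((x - thr \<nu> b j i k) / b j i)) - lap_cdf ((- x - thr \<nu> b j i k) / b j i)"
    by (simp add: laplace_measure_halfline[OF assms(1)] minus_divide_left)
  also have "\<dots> = Gfun \<nu> b j i k x" unfolding lap_cdf_minus Gfun_def by simp
  finally show ?thesis .
qed

text \<open>Both arguments of the first \<open>lap_cdf\<close> term have modulus at most
  \<open>(R + C) / b\<close>, where \<open>C\<close> is the threshold. Since
  \<open>C / b = \<nu> ln k\<close>, the density there is at least \<open>exp (- R / b) / 2\<close>
  divided by \<open>k powr \<nu>\<close>. The second \<open>lap_cdf\<close> term changes in the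
  favourable direction and is dropped.\<close>

lemma Gfun_increment:
  assumes "0 < b i j" "0 < k" "0 \<le> \<nu> i j" "\<bar>x\<bar> \<le> R" "\<bar>y\<bar> \<le> R"
  shows "(x - y) * (Gfun \<nu> b i j k x - Gfun \<nu> b i j k y)
    \<ge> exp (- R / b i j) / (2 * b i j) * (x - y)\<^sup>2 / real k powr \<nu> i j"
proof -
  have *: "(x - y) * (Gfun \<nu> b i j k x - Gfun \<nu> b i j k y)
    \<ge> exp (- R / b i j) / (2 * b i j) * (x - y)\<^sup>2 / real k powr \<nu> i j"
    if xy: "y \<le> x" and "\<bar>x\<bar> \<le> R" "\<bar>y\<bar> \<le> R" for x y
  proof -
    let ?C = "thr \<nu> b i j k" and ?b = "b i j"
    let ?T = "R / ?b + \<nu> i j * ln (real k)"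
    have C: "?C = ?b * (\<nu> i j * ln (real k))" by (simp add: thr_def)
    have C0: "0 \<le> ?C" unfolding thr_def using assms by auto
    have T: "?T = (R + ?C) / ?b" unfolding C using assms by (simp add: field_simps)
    have "((x - ?C) / ?b - (y - ?C) / ?b) * (exp (- ?T) / 2) \<le> lap_cdf ((x - ?C) / ?b) - lap_cdf ((y - ?C) / ?b)"
      by (rule lap_cdf_increment) (unfold T, use assms that C0 in \<open>auto simp: divide_right_mono\<close>)
    moreover have "lap_cdf ((- x - ?C) / ?b) \<le> lap_cdf ((- y - ?C) / ?b)"
      using assms xy by (intro lap_cdf_mono divide_right_mono) auto
    moreover have "(x - ?C) / ?b - (y - ?C) / ?b = (x - y) / ?b" by (simp add: diff_divide_distrib)
    ultimately have "(x - y) / ?b * (exp (- ?T) / 2) \<le> Gfun \<nu> b i j k x - Gfun \<nu> b i j k y"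
      unfolding Gfun_def by simp
    then have "(x - y) * ((x - y) / ?b * (exp (- ?T) / 2)) \<le> (x - y) * (Gfun \<nu> b i j k x - Gfun \<nu> b i j k y)"
      using xy by (intro mult_left_mono) auto
    moreover have E: "exp (- ?T) = exp (- R / ?b) / real k powr \<nu> i j"
      using assms by (simp add: powr_def exp_diff exp_add exp_minus divide_inverse)
    have "exp (- R / ?b) / (2 * ?b) * (x - y)\<^sup>2 / real k powr \<nu> i j
        = (x - y) * ((x - y) / ?b * (exp (- ?T) / 2))"
      unfolding E by (simp add: power2_eq_square mult_ac)
    ultimately show ?thesis by simp
  qed
  show ?thesis
  proof (cases "y \<le> x")
    case False
    then show ?thesis using *[of x y] assms by (auto simp: power2_commute algebra_simps)
  qed (use * assms in blast)
qed

section \<open>Sample paths\<close>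

text \<open>Passing to \<open>ln (1 + V)\<close> divides the noise \<open>M\<close> by \<open>1 + V\<close>, so that the summability
  hypothesis can be met without an a priori bound on \<open>V\<close>.\<close>

lemma perturbed_descent_converges:
  fixes V D M A :: "nat \<Rightarrow> real"
  assumes V0: "\<And>k. 0 \<le> V k" and D0: "\<And>k. 0 \<le> D k"
    and A: "summable A" and M: "summable (\<lambda>k. M k / (1 + V k))"
    and rec: "\<And>k. V (Suc k) \<le> V k - D k + M k + A k * (1 + V k)"
  shows "convergent V" and "summable D"
proof -
  define L where "L k = ln (1 + V k)" for k
  define S where "S k = (\<Sum>j<k. M j / (1 + V j) + A j)" for k
  define P where "P k = (\<Sum>j<k. D j / (1 + V j))" for k
  \<comment> \<open>Adding the dissipation spent so far and removing the accumulated noise turns the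
    logarithm into a decreasing sequence that is bounded below. Its convergence bounds
    \<open>P\<close> first, and then carries over to \<open>L\<close>.\<close>
  define U where "U k = L k + P k - S k" for k
  have V1: "0 < 1 + V k" for k using V0[of k] by simp
  have step: "L (Suc k) \<le> L k - D k / (1 + V k) + (M k / (1 + V k) + A k)" for k
  proof -
    have *: "(u - d + m + a * u) / u - 1 = - d / u + (m / u + a)" if "0 < u" for u d m a :: real
      using that by (simp add: field_simps)
    have "L (Suc k) - L k = ln ((1 + V (Suc k)) / (1 + V k))"
      unfolding L_def using V1[of k] V1[of "Suc k"] by (subst ln_div) auto
    also have "\<dots> \<le> (1 + V (Suc k)) / (1 + V k) - 1"
      using V1[of k] V1[of "Suc k"] by (intro ln_le_minus_one) simp
    also have "\<dots> \<le> ((1 + V k) - D k + M k + A k * (1 + V k)) / (1 + V k) - 1"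
      using rec[of k] V1[of k] by (intro diff_right_mono divide_right_mono) auto
    also have "\<dots> = - D k / (1 + V k) + (M k / (1 + V k) + A k)"
      by (rule *[OF V1])
    finally show ?thesis by simp
  qed
  have "decseq U"
    unfolding decseq_Suc_iff U_def P_def S_def using step by (simp add: algebra_simps)
  have convS: "convergent S"
    unfolding S_def using summable_add[OF M A] by (simp add: summable_iff_convergent)
  then obtain B where B: "\<And>k. \<bar>S k\<bar> \<le> B"
    using convergent_imp_Bseq[OF convS] unfolding Bseq_def by auto
  have L0: "0 \<le> L k" for k unfolding L_def using V0 by simp
  have P0: "0 \<le> P k" for k unfolding P_def using V0 D0 by (intro sum_nonneg) (simp add: add_nonneg_nonneg)
  have "- B \<le> U k" for k using L0[of k] P0[of k] B[of k] unfolding U_def by linarith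
  then have convU: "convergent U"
    using \<open>decseq U\<close> by (metis convergentI decseq_convergent)
  have "P k \<le> U 0 + B" for k
    using decseqD[OF \<open>decseq U\<close>, of 0 k] L0[of k] B[of k] unfolding U_def by linarith
  then have sumDV: "summable (\<lambda>j. D j / (1 + V j))"
    using V0 D0 unfolding P_def by (intro summableI_nonneg_bounded) (auto intro!: divide_nonneg_nonneg add_nonneg_nonneg)
  then have convP: "convergent P" unfolding P_def by (simp add: summable_iff_convergent)
  have "L = (\<lambda>k. U k + S k - P k)" by (auto simp: U_def)
  then have "convergent L" using convU convS convP by (auto intro!: convergent_add convergent_diff)
  then obtain l where "L \<longlonglongrightarrow> l" by (auto simp: convergent_def)
  then have "(\<lambda>k. exp (L k) - 1) \<longlonglongrightarrow> exp l - 1" by (intro tendsto_intros)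
  then show cV: "convergent V" unfolding L_def using V1 by (auto simp: convergent_def)
  \<comment> \<open>Now that \<open>V\<close> is known to be bounded, the weights
    \<open>1 / (1 + V k)\<close> can be removed from the dissipation series.\<close>
  then obtain B where B: "\<And>k. V k \<le> B"
    using convergent_imp_Bseq[OF cV] unfolding Bseq_def by (auto simp: abs_le_iff)
  show "summable D"
  proof (rule summable_comparison_test'[OF summable_mult[OF sumDV]])
    fix k
    have "D k = (1 + V k) * (D k / (1 + V k))" using V1[of k] by simp
    also have "\<dots> \<le> (1 + B) * (D k / (1 + V k))"
      using B D0[of k] V1[of k] by (intro mult_right_mono) auto
    finally show "norm (D k) \<le> (1 + B) * (D k / (1 + V k))" using D0[of k] by simp
  qed
qed

text \<open>If \<open>V\<close> had a positive limit, the window sums of \<open>Q\<close> would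
  eventually exceed a positive constant. As \<open>z k * Q k\<close> is summable and the values of
  \<open>z\<close> inside a window are comparable, \<open>z\<close> itself would be summable. The
  sequence \<open>\<epsilon>\<close> leaves room for the drift of the error during a window.\<close>

lemma descent_limit_zero:
  fixes V D Q z \<epsilon> :: "nat \<Rightarrow> real"
  assumes V: "convergent V" "\<And>k. 0 \<le> V k"
    and D: "summable D" "\<And>k. c0 * (z k * Q k) \<le> D k" and c0: "0 < c0"
    and Q: "\<And>k. 0 \<le> Q k"
    and z: "\<And>k. 0 \<le> z k" "\<And>k. z (Suc k) \<le> c * z k" "\<not> summable z" and c: "1 \<le> c"
    and window: "\<And>k. V k \<le> K * (\<Sum>t<P. Q (k + t)) + \<epsilon> k" and K: "0 < K"
    and \<epsilon>: "\<epsilon> \<longlonglongrightarrow> 0"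
  shows "V \<longlonglongrightarrow> 0"
proof -
  obtain v where v: "V \<longlonglongrightarrow> v" using V by (auto simp: convergent_def)
  have "v = 0"
  proof (rule ccontr)
    assume "v \<noteq> 0"
    then have "0 < v" using LIMSEQ_le_const[OF v, of 0] V by fastforce
    have "(\<lambda>k. V k - \<epsilon> k) \<longlonglongrightarrow> v - 0" using v \<epsilon> by (rule tendsto_diff)
    then have "eventually (\<lambda>k. v / 2 < V k - \<epsilon> k) sequentially"
      using \<open>0 < v\<close> by (intro order_tendstoD) auto
    then have ev: "eventually (\<lambda>k. v / (2 * K) \<le> (\<Sum>t<P. Q (k + t))) sequentially"
    proof eventually_elim
      case (elim k)
      then have "v / 2 \<le> K * (\<Sum>t<P. Q (k + t))" using window[of k] by linarith
      then show ?case using K by (simp add: field_simps)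
    qed
    have zpow: "z (k + s) \<le> c ^ s * z k" for k s
    proof (induction s)
      case (Suc s)
      have "z (k + Suc s) \<le> c * z (k + s)" using z(2)[of "k + s"] by simp
      also have "\<dots> \<le> c * (c ^ s * z k)" using Suc c by (intro mult_left_mono) auto
      finally show ?case by simp
    qed simp
    \<comment> \<open>The common factor is taken at the end of the window, because the growth
      condition bounds later values of \<open>z\<close> by earlier ones and not conversely.\<close>
    have zP: "z (k + P) \<le> c ^ P * z (k + t)" if "t < P" for k t
    proof -
      have "z (k + P) \<le> c ^ (P - t) * z (k + t)" using zpow[of "k + t" "P - t"] that by simp
      also have "\<dots> \<le> c ^ P * z (k + t)"
        using c z by (intro mult_right_mono power_increasing) auto
      finally show ?thesis .
    qed
    have "summable (\<lambda>k. c ^ P / c0 * (\<Sum>t<P. D (k + t)))"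
      using D(1) by (intro summable_mult summable_sum) (simp add: summable_iff_shift)
    then have "summable (\<lambda>k. v / (2 * K) * z (k + P))"
    proof (rule summable_comparison_test_ev[rotated])
      show "eventually (\<lambda>k. norm (v / (2 * K) * z (k + P)) \<le> c ^ P / c0 * (\<Sum>t<P. D (k + t))) sequentially"
        using ev
      proof eventually_elim
        case (elim k)
        have "v / (2 * K) * z (k + P) \<le> (\<Sum>t<P. Q (k + t)) * z (k + P)"
          using elim z by (intro mult_right_mono) auto
        also have "\<dots> = (\<Sum>t<P. z (k + P) * Q (k + t))"
          by (subst sum_distrib_right) (simp add: mult.commute)
        also have "\<dots> \<le> (\<Sum>t<P. c ^ P / c0 * D (k + t))"
        proof (rule sum_mono)
          fix t assume "t \<in> {..<P}"
          then have "z (k + P) * Q (k + t) \<le> c ^ P * z (k + t) * Q (k + t)"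
            using zP Q by (intro mult_right_mono) auto
          also have "\<dots> = c ^ P / c0 * (c0 * (z (k + t) * Q (k + t)))" using c0 by simp
          also have "\<dots> \<le> c ^ P / c0 * D (k + t)"
            using D(2)[of "k + t"] c c0 by (intro mult_left_mono) auto
          finally show "z (k + P) * Q (k + t) \<le> c ^ P / c0 * D (k + t)" .
        qed
        also have "\<dots> = c ^ P / c0 * (\<Sum>t<P. D (k + t))" by (simp add: sum_distrib_left)
        finally show ?case using \<open>0 < v\<close> K z(1)[of "k + P"] by simp
      qed
    qed
    then have "summable z" using \<open>0 < v\<close> K by (simp add: summable_cmult_iff summable_iff_shift)
    then show False using z by simp
  qed
  then show ?thesis using v by simp
qed

section \<open>Quadratic forms on a connected graph and sums over edges\<close>

lemma finite_edges: "finite (edges N a)"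
  by (rule finite_subset[of _ "{1..N} \<times> {1..N}"]) (auto simp: edges_def)

text \<open>A Poincare inequality, in the role of a positive second eigenvalue of the Laplacian.
  Along a path the constant is built edge by edge: an edge \<open>(u, v)\<close> turns
  \<open>C\<close> into \<open>2 * C + 2 / a u v\<close>. It has to be independent of
  \<open>y\<close>, so it is chosen before \<open>y\<close> in the induction; the finitely many
  pairs of sensors are then covered by the sum of their constants.\<close>

lemma connected_edge_energy:
  assumes "graph_connected N a"
  obtains C where "0 \<le> C"
    and "\<And>(y::nat \<Rightarrow> real) i j. i \<in> {1..N} \<Longrightarrow> j \<in> {1..N} \<Longrightarrow>
      (y i - y j)\<^sup>2 \<le> C * (\<Sum>(u, v)\<in>edges N a. a u v * (y u - y v)\<^sup>2)"
proof -
  let ?S = "\<lambda>y::nat \<Rightarrow> real. \<Sum>(u, v)\<in>edges N a. a u v * (y u - y v)\<^sup>2"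
  have S0: "0 \<le> ?S y" for y by (intro sum_nonneg) (auto simp: edges_def)
  have "\<exists>C\<ge>0. \<forall>y. (y i - y j)\<^sup>2 \<le> C * ?S y" if "(i, j) \<in> (edges N a)\<^sup>*" for i j
    using that
  proof (induction rule: rtrancl_induct)
    case base
    show ?case using S0 by (auto intro!: exI[of _ 0])
  next
    case (step u v)
    then obtain C where C: "0 \<le> C" "\<And>y. (y i - y u)\<^sup>2 \<le> C * ?S y" by blast
    have a: "0 < a u v" using step by (auto simp: edges_def)
    have e: "a u v * (y u - y v)\<^sup>2 \<le> ?S y" for y
      using member_le_sum[of "(u, v)" "edges N a" "\<lambda>(u, v). a u v * (y u - y v)\<^sup>2"] step(2) finite_edges
      by (auto simp: edges_def)
    have "(y i - y v)\<^sup>2 \<le> (2 * C + 2 / a u v) * ?S y" for y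
    proof -
      have "(y u - y v)\<^sup>2 \<le> ?S y / a u v" using e[of y] a by (simp add: field_simps)
      moreover have "(y i - y v)\<^sup>2 \<le> 2 * (y i - y u)\<^sup>2 + 2 * (y u - y v)\<^sup>2"
        using sum_squares_bound[of "y i - y u" "y u - y v"] by (simp add: power2_eq_square algebra_simps)
      ultimately have "(y i - y v)\<^sup>2 \<le> 2 * (C * ?S y) + 2 * (?S y / a u v)"
        using C(2)[of y] by linarith
      then show ?thesis by (simp add: algebra_simps)
    qed
    then show ?case using C(1) a by (intro exI[of _ "2 * C + 2 / a u v"]) auto
  qed
  then have "\<forall>q\<in>{1..N} \<times> {1..N}. \<exists>C\<ge>0. \<forall>y. (y (fst q) - y (snd q))\<^sup>2 \<le> C * ?S y"
    using assms unfolding graph_connected_def by auto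
  from bchoice[OF this] obtain C where
    "\<forall>q\<in>{1..N} \<times> {1..N}. 0 \<le> C q \<and> (\<forall>y. (y (fst q) - y (snd q))\<^sup>2 \<le> C q * ?S y)" ..
  then have C: "\<And>q. q \<in> {1..N} \<times> {1..N} \<Longrightarrow> 0 \<le> C q"
    "\<And>q y. q \<in> {1..N} \<times> {1..N} \<Longrightarrow> (y (fst q) - y (snd q))\<^sup>2 \<le> C q * ?S y"
    by blast+
  have "(y i - y j)\<^sup>2 \<le> (\<Sum>q\<in>{1..N} \<times> {1..N}. C q) * ?S y" if "i \<in> {1..N}" "j \<in> {1..N}" for y i j
  proof -
    have q: "(i, j) \<in> {1..N} \<times> {1..N}" using that by auto
    have "C (i, j) \<le> (\<Sum>q\<in>{1..N} \<times> {1..N}. C q)" by (rule member_le_sum[OF q]) (use C in auto)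
    then have "C (i, j) * ?S y \<le> (\<Sum>q\<in>{1..N} \<times> {1..N}. C q) * ?S y"
      using S0 by (intro mult_right_mono) auto
    then show ?thesis using C(2)[OF q, of y] by simp
  qed
  moreover have "0 \<le> (\<Sum>q\<in>{1..N} \<times> {1..N}. C q)" using C(1) by (intro sum_nonneg) auto
  ultimately show thesis using that by blast
qed

text \<open>Moving the window by one step drops the residue of \<open>k\<close> and gains the
  residue of \<open>k + n\<close>, which is the same.\<close>

lemma sum_mod_window:
  fixes g :: "nat \<Rightarrow> 'b::ab_group_add"
  shows "(\<Sum>t<n. g ((k + t) mod n)) = (\<Sum>l<n. g l)"
proof (induction k)
  case (Suc k)
  have "(\<Sum>t<n. g ((Suc k + t) mod n)) = (\<Sum>t<Suc n. g ((k + t) mod n)) - g (k mod n)"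
    by (subst sum.lessThan_Suc_shift) simp
  then show ?case using Suc by simp
qed simp

lemma square_sum_le:
  fixes x y :: "'b \<Rightarrow> real"
  assumes "\<And>i. i \<in> I \<Longrightarrow> \<bar>x i\<bar> \<le> B"
  shows "(\<Sum>i\<in>I. x i * y i)\<^sup>2 \<le> real (card I) * B\<^sup>2 * (\<Sum>i\<in>I. (y i)\<^sup>2)"
proof -
  have "(\<Sum>i\<in>I. x i * y i)\<^sup>2 \<le> (\<Sum>i\<in>I. (x i)\<^sup>2) * (\<Sum>i\<in>I. (y i)\<^sup>2)"
    by (rule Cauchy_Schwarz_ineq_sum)
  also have "(\<Sum>i\<in>I. (x i)\<^sup>2) \<le> (\<Sum>i\<in>I. B\<^sup>2)"
    by (rule sum_mono) (use assms abs_le_square_iff in fastforce)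
  then have "(\<Sum>i\<in>I. (x i)\<^sup>2) * (\<Sum>i\<in>I. (y i)\<^sup>2) \<le> (\<Sum>i\<in>I. B\<^sup>2) * (\<Sum>i\<in>I. (y i)\<^sup>2)"
    by (intro mult_right_mono sum_nonneg) auto
  finally show ?thesis by simp
qed

lemma edges_eq_Sigma: "edges N a = Sigma {1..N} (nbrs N a)"
  by (auto simp: nbrs_def edges_def)

lemma finite_nbrs: "finite (nbrs N a i)"
  by (rule finite_subset[of _ "{1..N}"]) (auto simp: edges_def nbrs_def)

lemma sum_edges: "(\<Sum>(i, j)\<in>edges N a. f i j) = (\<Sum>i\<in>{1..N}. \<Sum>j\<in>nbrs N a i. f i j)"
  unfolding edges_eq_Sigma by (subst sum.Sigma) (auto simp: finite_nbrs)

lemma sum_edges_swap: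
  assumes "\<And>i j. a i j = a j i"
  shows "(\<Sum>(i, j)\<in>edges N a. f i j) = (\<Sum>(i, j)\<in>edges N a. f j i)"
  by (rule sum.reindex_bij_witness[of _ prod.swap prod.swap]) (auto simp: edges_def assms)

lemma square_le_split: "(x::real)\<^sup>2 \<le> 2 * y\<^sup>2 + 2 * (x - y)\<^sup>2"
  using zero_le_power2[of "x - 2 * y"] by (simp add: power2_eq_square algebra_simps)

lemma square_le_split3: "(x + (y - z))\<^sup>2 \<le> 3 * (x\<^sup>2 + y\<^sup>2 + (z::real)\<^sup>2)"
  using zero_le_power2[of "x - y"] zero_le_power2[of "x + z"] zero_le_power2[of "y + z"]
  by (simp add: power2_eq_square algebra_simps)

text \<open>Vectors are given by their coordinates. The step from \<open>k\<close> to \<open>Suc k\<close> is the step with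
  time index \<open>Suc k\<close> of the algorithm, so that its regressor selects coordinate \<open>k mod n\<close>;
  the sequence \<open>z\<close> is shifted in the same way.\<close>

locale sc_network =
  fixes n N :: nat and m :: "nat \<Rightarrow> nat"
    and a \<nu> b :: "nat \<Rightarrow> nat \<Rightarrow> real"
    and \<alpha> :: "nat \<Rightarrow> nat \<Rightarrow> nat \<Rightarrow> real" and \<beta> :: "nat \<Rightarrow> nat \<Rightarrow> real"
    and h :: "nat \<Rightarrow> nat \<Rightarrow> nat \<Rightarrow> nat \<Rightarrow> real"
    and Hb \<delta> c :: real and p :: nat and z :: "nat \<Rightarrow> real"
  assumes n_pos: "0 < n" and N_pos: "0 < N"
    and a_sym: "\<And>i j. a i j = a j i" and connected: "graph_connected N a"
    and h_bound: "\<And>i k r l. i \<in> {1..N} \<Longrightarrow> r < m i \<Longrightarrow> l < n \<Longrightarrow> \<bar>h i (Suc k) r l\<bar> \<le> Hb"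
    and \<delta>_pos: "0 < \<delta>"
    and persistent: "\<And>k x. \<delta> * (\<Sum>l<n. (x l)\<^sup>2)
      \<le> (\<Sum>t<p. \<Sum>i\<in>{1..N}. \<Sum>r<m i. (\<Sum>l<n. h i (Suc (k + t)) r l * x l)\<^sup>2)"
    and \<nu>_sym: "\<And>i j. \<nu> i j = \<nu> j i" and \<nu>_nonneg: "\<And>i j. (i, j) \<in> edges N a \<Longrightarrow> 0 \<le> \<nu> i j"
    and b_sym: "\<And>i j. b i j = b j i" and b_pos: "\<And>i j. (i, j) \<in> edges N a \<Longrightarrow> 0 < b i j"
    and \<alpha>_sym: "\<And>i j k. \<alpha> i j k = \<alpha> j i k"
    and \<alpha>_pos: "\<And>i j k. (i, j) \<in> edges N a \<Longrightarrow> 0 < \<alpha> i j (Suc k)"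
    and \<beta>_pos: "\<And>i k. i \<in> {1..N} \<Longrightarrow> 0 < \<beta> i (Suc k)"
    and \<alpha>_square_summable: "\<And>i j. (i, j) \<in> edges N a \<Longrightarrow> summable (\<lambda>k. (\<alpha> i j (Suc k))\<^sup>2)"
    and \<beta>_square_summable: "\<And>i. i \<in> {1..N} \<Longrightarrow> summable (\<lambda>k. (\<beta> i (Suc k))\<^sup>2)"
    and z_nonneg: "\<And>k. 0 \<le> z k"
    and z_le_\<alpha>: "\<And>i j k. (i, j) \<in> edges N a \<Longrightarrow> z k \<le> \<alpha> i j (Suc k) / real (Suc k) powr \<nu> i j"
    and z_le_\<beta>: "\<And>i k. i \<in> {1..N} \<Longrightarrow> z k \<le> \<beta> i (Suc k)"
    and c_ge_1: "1 \<le> c" and z_ratio: "\<And>k. z (Suc k) \<le> c * z k"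
    and z_not_summable: "\<not> summable z"
begin

definition nsq :: "(nat \<Rightarrow> nat \<Rightarrow> real) \<Rightarrow> real" where
  "nsq f = (\<Sum>i\<in>{1..N}. \<Sum>l<n. (f i l)\<^sup>2)"

definition obs :: "nat \<Rightarrow> nat \<Rightarrow> (nat \<Rightarrow> real) \<Rightarrow> nat \<Rightarrow> real" where
  "obs i k x r = (\<Sum>l<n. h i (Suc k) r l * x l)"

text \<open>The edge part sees only the coordinate selected in this step. Step sizes are left out,
  so that one factor \<open>z k\<close> can serve for the edge part and for the observation
  part.\<close>

definition energy :: "nat \<Rightarrow> (nat \<Rightarrow> nat \<Rightarrow> real) \<Rightarrow> real" where
  "energy k f = (\<Sum>(i, j)\<in>edges N a. a i j * (f i (k mod n) - f j (k mod n))\<^sup>2)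
    + (\<Sum>i\<in>{1..N}. \<Sum>r<m i. (obs i k (f i) r)\<^sup>2)"

lemma a_pos: "(i, j) \<in> edges N a \<Longrightarrow> 0 < a i j"
  by (auto simp: edges_def)

lemma nsq_nonneg: "0 \<le> nsq f"
  unfolding nsq_def by (intro sum_nonneg) auto

lemma sum_square_le_nsq: "i \<in> {1..N} \<Longrightarrow> (\<Sum>l<n. (f i l)\<^sup>2) \<le> nsq f"
  unfolding nsq_def by (rule member_le_sum) (auto intro: sum_nonneg)

lemma square_le_nsq: "i \<in> {1..N} \<Longrightarrow> l < n \<Longrightarrow> (f i l)\<^sup>2 \<le> nsq f"
  by (rule order_trans[OF _ sum_square_le_nsq[of i f]]) (auto intro!: member_le_sum)

lemma obs_diff: "obs i k (\<lambda>l. x l - y l) r = obs i k x r - obs i k y r"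
  by (simp add: obs_def algebra_simps sum_subtractf)

lemma obs_square_le:
  "i \<in> {1..N} \<Longrightarrow> r < m i \<Longrightarrow> (obs i k x r)\<^sup>2 \<le> real n * Hb\<^sup>2 * (\<Sum>l<n. (x l)\<^sup>2)"
  unfolding obs_def using square_sum_le[of "{..<n}" "h i (Suc k) r" Hb x] h_bound by simp

lemma energy_nonneg: "0 \<le> energy k f"
  unfolding energy_def using a_pos by (intro add_nonneg_nonneg sum_nonneg) (auto simp: less_imp_le)

text \<open>\<open>energy k\<close> is a nonnegative combination of squares of linear functionals,
  so \<open>square_le_split\<close> applies term by term. It is used to exchange the error frozen at
  the start of a window for the current one.\<close>

lemma energy_split: "energy k f \<le> 2 * energy k g + 2 * energy k (\<lambda>i l. f i l - g i l)"
proof -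
  let ?q = "k mod n"
  have "(\<Sum>(i, j)\<in>edges N a. a i j * (f i ?q - f j ?q)\<^sup>2)
      \<le> (\<Sum>(i, j)\<in>edges N a. 2 * (a i j * (g i ?q - g j ?q)\<^sup>2) + 2 * (a i j * ((f i ?q - g i ?q) - (f j ?q - g j ?q))\<^sup>2))"
  proof (rule sum_mono, clarsimp)
    fix i j assume e: "(i, j) \<in> edges N a"
    have "(f i ?q - f j ?q)\<^sup>2 \<le> 2 * (g i ?q - g j ?q)\<^sup>2 + 2 * ((f i ?q - f j ?q) - (g i ?q - g j ?q))\<^sup>2"
      by (rule square_le_split)
    also have "(f i ?q - f j ?q) - (g i ?q - g j ?q) = (f i ?q - g i ?q) - (f j ?q - g j ?q)" by simp
    finally have "a i j * (f i ?q - f j ?q)\<^sup>2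
        \<le> a i j * (2 * (g i ?q - g j ?q)\<^sup>2 + 2 * ((f i ?q - g i ?q) - (f j ?q - g j ?q))\<^sup>2)"
      using a_pos[OF e] by (intro mult_left_mono) auto
    then show "a i j * (f i ?q - f j ?q)\<^sup>2
        \<le> 2 * (a i j * (g i ?q - g j ?q)\<^sup>2) + 2 * (a i j * ((f i ?q - g i ?q) - (f j ?q - g j ?q))\<^sup>2)"
      by (simp add: distrib_left)
  qed
  moreover have "(\<Sum>i\<in>{1..N}. \<Sum>r<m i. (obs i k (f i) r)\<^sup>2)
      \<le> (\<Sum>i\<in>{1..N}. \<Sum>r<m i. 2 * (obs i k (g i) r)\<^sup>2 + 2 * (obs i k (\<lambda>l. f i l - g i l) r)\<^sup>2)"
    unfolding obs_diff by (intro sum_mono square_le_split)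
  ultimately show ?thesis
    unfolding energy_def by (simp add: sum.distrib sum_distrib_left case_prod_unfold)
qed

lemma energy_le: obtains C where "0 \<le> C" and "\<And>k f. energy k f \<le> C * nsq f"
proof
  let ?C = "(\<Sum>(i, j)\<in>edges N a. a i j * 4) + (\<Sum>i\<in>{1..N}. \<Sum>r<m i. real n * Hb\<^sup>2)"
  show "0 \<le> ?C" using a_pos by (intro add_nonneg_nonneg sum_nonneg) (auto simp: less_imp_le)
  fix k f
  let ?q = "k mod n"
  have "(\<Sum>(i, j)\<in>edges N a. a i j * (f i ?q - f j ?q)\<^sup>2) \<le> (\<Sum>(i, j)\<in>edges N a. a i j * 4 * nsq f)"
  proof (rule sum_mono, clarsimp)
    fix i j assume e: "(i, j) \<in> edges N a"
    then have ij: "i \<in> {1..N}" "j \<in> {1..N}" by (auto simp: edges_def)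
    have "?q < n" using n_pos by simp
    then have "(f i ?q)\<^sup>2 \<le> nsq f" "(f j ?q)\<^sup>2 \<le> nsq f" using ij square_le_nsq by blast+
    moreover have "(f i ?q - f j ?q)\<^sup>2 \<le> 2 * (f i ?q)\<^sup>2 + 2 * (f j ?q)\<^sup>2"
      using square_le_split[of "f i ?q - f j ?q" "f i ?q"] by simp
    ultimately have "(f i ?q - f j ?q)\<^sup>2 \<le> 4 * nsq f" by linarith
    then show "a i j * (f i ?q - f j ?q)\<^sup>2 \<le> a i j * 4 * nsq f"
      using a_pos[OF e] by (simp add: mult.assoc)
  qed
  moreover have "(\<Sum>i\<in>{1..N}. \<Sum>r<m i. (obs i k (f i) r)\<^sup>2) \<le> (\<Sum>i\<in>{1..N}. \<Sum>r<m i. real n * Hb\<^sup>2 * nsq f)"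
  proof (intro sum_mono)
    fix i r assume "i \<in> {1..N}" "r \<in> {..<m i}"
    then have "(obs i k (f i) r)\<^sup>2 \<le> real n * Hb\<^sup>2 * (\<Sum>l<n. (f i l)\<^sup>2)" by (intro obs_square_le) auto
    also have "\<dots> \<le> real n * Hb\<^sup>2 * nsq f"
      using \<open>i \<in> {1..N}\<close> by (intro mult_left_mono sum_square_le_nsq) auto
    finally show "(obs i k (f i) r)\<^sup>2 \<le> real n * Hb\<^sup>2 * nsq f" .
  qed
  ultimately show "energy k f \<le> ?C * nsq f"
    unfolding energy_def by (simp add: distrib_right sum_distrib_right case_prod_unfold mult.assoc)
qed

text \<open>Joint observability: over \<open>n\<close> steps the consensus terms see every coordinate, and over \<open>p\<close>
  steps the observation terms see the common value.\<close>

lemma nsq_le_window_energy: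
  obtains K where "0 < K" and "\<And>k f. nsq f \<le> K * (\<Sum>t<n + p. energy (k + t) f)"
proof -
  obtain C where C: "0 \<le> C" and
    CE: "\<And>(y::nat \<Rightarrow> real) i j. i \<in> {1..N} \<Longrightarrow> j \<in> {1..N} \<Longrightarrow>
      (y i - y j)\<^sup>2 \<le> C * (\<Sum>(u, v)\<in>edges N a. a u v * (y u - y v)\<^sup>2)"
    using connected_edge_energy[OF connected] by blast
  \<comment> \<open>\<open>B\<close> is the price of replacing the errors \<open>f i\<close> by a
    common vector in the observation terms, and \<open>T\<close> is the resulting bound for one
    sensor. The summand \<open>1\<close> in \<open>K\<close> makes its positivity immediate.\<close>
  define B where "B = (\<Sum>t<p. \<Sum>i\<in>{1..N}. \<Sum>r<m i. 2 * (real n * Hb\<^sup>2 * C))"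
  define T where "T = 2 * ((2 + B) / \<delta>) + 2 * C"
  define K where "K = 1 + real N * T"
  have B0: "0 \<le> B" unfolding B_def using C by (intro sum_nonneg) auto
  have K1: "1 \<le> K" unfolding K_def T_def using C B0 \<delta>_pos by auto
  have "nsq f \<le> K * (\<Sum>t<n + p. energy (k + t) f)" for k f
  proof -
    define W where "W = (\<Sum>t<n + p. energy (k + t) f)"
    define E where "E l = (\<Sum>(u, v)\<in>edges N a. a u v * (f u l - f v l)\<^sup>2)" for l
    \<comment> \<open>Sensor \<open>1\<close> is the reference for the common vector; it exists
      because \<open>N\<close> is positive.\<close>
    define x where "x = f 1"
    have W0: "0 \<le> W" unfolding W_def by (intro sum_nonneg energy_nonneg)
    have "(\<Sum>l<n. E l) = (\<Sum>t<n. E ((k + t) mod n))" by (rule sum_mod_window[symmetric])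
    also have "\<dots> \<le> (\<Sum>t<n. energy (k + t) f)"
      by (intro sum_mono) (auto simp: energy_def E_def intro!: sum_nonneg)
    also have "\<dots> \<le> W" unfolding W_def by (intro sum_mono2 energy_nonneg) auto
    finally have EW: "(\<Sum>l<n. E l) \<le> W" .
    have "(\<Sum>t<p. \<Sum>i\<in>{1..N}. \<Sum>r<m i. (obs i (k + t) (f i) r)\<^sup>2) \<le> (\<Sum>t<p. energy (k + t) f)"
      using a_pos by (intro sum_mono) (auto simp: energy_def less_imp_le intro!: sum_nonneg)
    also have "\<dots> \<le> W" unfolding W_def by (intro sum_mono2 energy_nonneg) auto
    finally have OW: "(\<Sum>t<p. \<Sum>i\<in>{1..N}. \<Sum>r<m i. (obs i (k + t) (f i) r)\<^sup>2) \<le> W" .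
    have dev: "(\<Sum>l<n. (x l - f i l)\<^sup>2) \<le> C * W" if i: "i \<in> {1..N}" for i
    proof -
      have "(\<Sum>l<n. (x l - f i l)\<^sup>2) \<le> (\<Sum>l<n. C * E l)"
        unfolding x_def E_def using i N_pos by (intro sum_mono CE) auto
      also have "\<dots> \<le> C * W" using EW C by (simp add: sum_distrib_left[symmetric] mult_left_mono)
      finally show ?thesis .
    qed
    have "\<delta> * (\<Sum>l<n. (x l)\<^sup>2) \<le> (\<Sum>t<p. \<Sum>i\<in>{1..N}. \<Sum>r<m i. (obs i (k + t) x r)\<^sup>2)"
      unfolding obs_def by (rule persistent)
    also have "\<dots> \<le> (\<Sum>t<p. \<Sum>i\<in>{1..N}. \<Sum>r<m i. 2 * (obs i (k + t) (f i) r)\<^sup>2 + 2 * (real n * Hb\<^sup>2 * C) * W)"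
    proof (intro sum_mono)
      fix t i r assume i: "i \<in> {1..N}" and r: "r \<in> {..<m i}"
      have "(obs i (k + t) x r - obs i (k + t) (f i) r)\<^sup>2 \<le> real n * Hb\<^sup>2 * (\<Sum>l<n. (x l - f i l)\<^sup>2)"
        unfolding obs_diff[symmetric] using i r by (intro obs_square_le) auto
      also have "\<dots> \<le> real n * Hb\<^sup>2 * (C * W)" using dev[OF i] by (intro mult_left_mono) auto
      finally show "(obs i (k + t) x r)\<^sup>2 \<le> 2 * (obs i (k + t) (f i) r)\<^sup>2 + 2 * (real n * Hb\<^sup>2 * C) * W"
        using square_le_split[of "obs i (k + t) x r" "obs i (k + t) (f i) r"] by (simp add: mult.assoc)
    qed
    also have "\<dots> = 2 * (\<Sum>t<p. \<Sum>i\<in>{1..N}. \<Sum>r<m i. (obs i (k + t) (f i) r)\<^sup>2) + B * W"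
      unfolding B_def sum.distrib sum_distrib_left sum_distrib_right ..
    also have "\<dots> \<le> (2 + B) * W" using OW by (simp add: distrib_right)
    finally have xW: "(\<Sum>l<n. (x l)\<^sup>2) \<le> (2 + B) / \<delta> * W"
      using \<delta>_pos by (simp add: field_simps)
    have "nsq f \<le> (\<Sum>i\<in>{1..N}. T * W)"
      unfolding nsq_def
    proof (rule sum_mono)
      fix i assume i: "i \<in> {1..N}"
      have "(\<Sum>l<n. (f i l)\<^sup>2) \<le> (\<Sum>l<n. 2 * (x l)\<^sup>2 + 2 * (x l - f i l)\<^sup>2)"
        by (rule sum_mono) (use square_le_split in \<open>metis power2_commute\<close>)
      also have "\<dots> = 2 * (\<Sum>l<n. (x l)\<^sup>2) + 2 * (\<Sum>l<n. (x l - f i l)\<^sup>2)"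
        by (simp add: sum.distrib sum_distrib_left)
      also have "\<dots> \<le> 2 * ((2 + B) / \<delta> * W) + 2 * (C * W)"
        using xW dev[OF i] by linarith
      finally show "(\<Sum>l<n. (f i l)\<^sup>2) \<le> T * W"
        unfolding T_def by (simp add: distrib_right mult.assoc)
    qed
    also have "\<dots> \<le> K * W" unfolding K_def using W0 by (simp add: distrib_right)
    finally show ?thesis unfolding W_def .
  qed
  then show thesis using that[of K] K1 by auto
qed

lemma Gfun_sym: "Gfun \<nu> b i j k = Gfun \<nu> b j i k"
  unfolding Gfun_def thr_def using \<nu>_sym[of i j] b_sym[of i j] by auto

end

text \<open>A sample path of the estimation errors. Here \<open>s k i j\<close> is the message that sensor \<open>i\<close> has from
  sensor \<open>j\<close>, and \<open>w k i r\<close> is the observation noise, in the step from \<open>k\<close> to \<open>Suc k\<close>.\<close>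

locale sc_path = sc_network +
  fixes \<theta> :: "nat \<Rightarrow> real" and e :: "nat \<Rightarrow> nat \<Rightarrow> nat \<Rightarrow> real"
    and s :: "nat \<Rightarrow> nat \<Rightarrow> nat \<Rightarrow> real" and w :: "nat \<Rightarrow> nat \<Rightarrow> nat \<Rightarrow> real"
  assumes step: "\<And>i l k. i \<in> {1..N} \<Longrightarrow> l < n \<Longrightarrow> e (Suc k) i l = e k i l
      + (if l = k mod n then \<Sum>j\<in>nbrs N a i. \<alpha> i j (Suc k) * a i j
          * (s k i j - Gfun \<nu> b i j (Suc k) (\<theta> (k mod n) + e k i (k mod n))) else 0)
      + \<beta> i (Suc k) * (\<Sum>r<m i. h i (Suc k) r l * (w k i r - obs i k (e k i) r))"
    and s_le: "\<And>i j k. \<bar>s k i j\<bar> \<le> 1"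
    and dither_noise: "\<And>i j. (i, j) \<in> edges N a \<Longrightarrow> summable (\<lambda>k. \<alpha> i j (Suc k)
      * (e k i (k mod n) / (1 + nsq (e k)))
      * (s k i j - Gfun \<nu> b i j (Suc k) (\<theta> (k mod n) + e k j (k mod n))))"
    and obs_noise: "\<And>i r. i \<in> {1..N} \<Longrightarrow> r < m i \<Longrightarrow>
      summable (\<lambda>k. \<beta> i (Suc k) * (obs i k (e k i) r / (1 + nsq (e k))) * w k i r)"
    and obs_noise_square: "\<And>i r. i \<in> {1..N} \<Longrightarrow> r < m i \<Longrightarrow>
      summable (\<lambda>k. (\<beta> i (Suc k))\<^sup>2 * (w k i r)\<^sup>2)"
begin

definition x :: "nat \<Rightarrow> nat \<Rightarrow> real" where
  "x k i = \<theta> (k mod n) + e k i (k mod n)"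

text \<open>The pair \<open>i j\<close> fixes the coefficients and \<open>u\<close> is the sensor
  whose value enters. So \<open>g k i j i\<close> is what the receiver subtracts, while
  \<open>g k i j j\<close> is the mean of the message from \<open>j\<close> given the past.\<close>

definition g :: "nat \<Rightarrow> nat \<Rightarrow> nat \<Rightarrow> nat \<Rightarrow> real" where
  "g k i j u = Gfun \<nu> b i j (Suc k) (x k u)"

definition inc :: "nat \<Rightarrow> nat \<Rightarrow> nat \<Rightarrow> real" where
  "inc k i l = e (Suc k) i l - e k i l"

definition consensus :: "nat \<Rightarrow> nat \<Rightarrow> real" where
  "consensus k i = (\<Sum>j\<in>nbrs N a i. \<alpha> i j (Suc k) * a i j * (s k i j - g k i j i))"

text \<open>The edge sum runs over ordered pairs and counts every undirected edge twice; hence it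
  lacks the factor \<open>2\<close> that the observation sum has.\<close>

definition dissipation :: "nat \<Rightarrow> real" where
  "dissipation k = (\<Sum>(i, j)\<in>edges N a. \<alpha> i j (Suc k) * a i j * ((x k i - x k j) * (g k i j i - g k i j j)))
    + 2 * (\<Sum>i\<in>{1..N}. \<beta> i (Suc k) * (\<Sum>r<m i. (obs i k (e k i) r)\<^sup>2))"

definition noise :: "nat \<Rightarrow> real" where
  "noise k = (\<Sum>(i, j)\<in>edges N a. 2 * a i j * (\<alpha> i j (Suc k) * e k i (k mod n) * (s k i j - g k i j j)))
    + (\<Sum>i\<in>{1..N}. \<Sum>r<m i. 2 * (\<beta> i (Suc k) * obs i k (e k i) r * w k i r))"

text \<open>A bound for \<open>nsq (inc k)\<close> in units of \<open>1 + nsq (e k)\<close>. The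
  three summands come from the messages, the observation noise and the observed error;
  \<open>3\<close> is from \<open>square_le_split3\<close>, and the squared \<open>2\<close> from
  bounding a message minus its \<open>G\<close> value.\<close>

definition perturbation :: "nat \<Rightarrow> real" where
  "perturbation k = (\<Sum>i\<in>{1..N}. \<Sum>l<n. 3 * (real (card (nbrs N a i)) * 2\<^sup>2 * (\<Sum>j\<in>nbrs N a i. (\<alpha> i j (Suc k) * a i j)\<^sup>2)
      + real (m i) * Hb\<^sup>2 * (\<Sum>r<m i. (\<beta> i (Suc k))\<^sup>2 * (w k i r)\<^sup>2)
      + real (m i) * Hb\<^sup>2 * (real (m i) * (real n * Hb\<^sup>2)) * (\<beta> i (Suc k))\<^sup>2))"

lemma q_less [simp]: "k mod n < n"
  using n_pos by simp

lemma inc_eq: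
  assumes "i \<in> {1..N}" "l < n"
  shows "inc k i l = (if l = k mod n then consensus k i else 0)
    + \<beta> i (Suc k) * (\<Sum>r<m i. h i (Suc k) r l * (w k i r - obs i k (e k i) r))"
  unfolding inc_def consensus_def g_def x_def using step[OF assms] by simp

lemma summable_perturbation: "summable perturbation"
  unfolding perturbation_def power_mult_distrib
  using \<alpha>_square_summable \<beta>_square_summable obs_noise_square
  by (intro summable_sum summable_mult summable_add summable_mult2) (auto simp: nbrs_def)

lemma nsq_inc_le: "nsq (inc k) \<le> perturbation k * (1 + nsq (e k))"
proof -
  let ?v = "nsq (e k)"
  have "nsq (inc k) \<le> (\<Sum>i\<in>{1..N}. \<Sum>l<n. 3 * (real (card (nbrs N a i)) * 2\<^sup>2 * (\<Sum>j\<in>nbrs N a i. (\<alpha> i j (Suc k) * a i j)\<^sup>2)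
      + real (m i) * Hb\<^sup>2 * (\<Sum>r<m i. (\<beta> i (Suc k))\<^sup>2 * (w k i r)\<^sup>2)
      + real (m i) * Hb\<^sup>2 * (real (m i) * (real n * Hb\<^sup>2)) * (\<beta> i (Suc k))\<^sup>2) * (1 + ?v))"
    unfolding nsq_def[of "inc k"]
  proof (intro sum_mono)
    fix i l assume i: "i \<in> {1..N}" and "l \<in> {..<n}"
    then have l: "l < n" by simp
    let ?b = "\<beta> i (Suc k)" and ?h = "\<lambda>r. h i (Suc k) r l"
    let ?X = "real (card (nbrs N a i)) * 2\<^sup>2 * (\<Sum>j\<in>nbrs N a i. (\<alpha> i j (Suc k) * a i j)\<^sup>2)"
    let ?Y = "real (m i) * Hb\<^sup>2 * (\<Sum>r<m i. ?b\<^sup>2 * (w k i r)\<^sup>2)"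
    let ?Z = "real (m i) * Hb\<^sup>2 * (real (m i) * (real n * Hb\<^sup>2)) * ?b\<^sup>2"
    have sg: "\<bar>s k i j - g k i j i\<bar> \<le> 2" for j
      unfolding g_def using s_le[of k i j] abs_Gfun_le[of \<nu> b i j "Suc k" "x k i"] by linarith
    have "(consensus k i)\<^sup>2 = (\<Sum>j\<in>nbrs N a i. (s k i j - g k i j i) * (\<alpha> i j (Suc k) * a i j))\<^sup>2"
      unfolding consensus_def by (simp add: mult.commute)
    also have "\<dots> \<le> ?X" by (rule square_sum_le) (use sg in blast)
    finally have X: "(if l = k mod n then consensus k i else 0)\<^sup>2 \<le> ?X"
      by (auto intro!: mult_nonneg_nonneg sum_nonneg)
    have hr: "\<bar>?h r\<bar> \<le> Hb" if "r \<in> {..<m i}" for r using that i l h_bound by auto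
    have "(?b * (\<Sum>r<m i. ?h r * w k i r))\<^sup>2 \<le> ?b\<^sup>2 * (real (card {..<m i}) * Hb\<^sup>2 * (\<Sum>r<m i. (w k i r)\<^sup>2))"
      unfolding power_mult_distrib by (intro mult_left_mono square_sum_le hr) auto
    also have "\<dots> = ?Y" by (simp add: sum_distrib_left[symmetric] mult_ac)
    finally have Y: "(?b * (\<Sum>r<m i. ?h r * w k i r))\<^sup>2 \<le> ?Y" .
    have "(?b * (\<Sum>r<m i. ?h r * obs i k (e k i) r))\<^sup>2
        \<le> ?b\<^sup>2 * (real (card {..<m i}) * Hb\<^sup>2 * (\<Sum>r<m i. (obs i k (e k i) r)\<^sup>2))"
      unfolding power_mult_distrib by (intro mult_left_mono square_sum_le hr) auto
    also have "\<dots> \<le> ?b\<^sup>2 * (real (card {..<m i}) * Hb\<^sup>2 * (\<Sum>r<m i. real n * Hb\<^sup>2 * ?v))"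
    proof (intro mult_left_mono sum_mono)
      fix r assume "r \<in> {..<m i}"
      then have "(obs i k (e k i) r)\<^sup>2 \<le> real n * Hb\<^sup>2 * (\<Sum>l<n. (e k i l)\<^sup>2)"
        using i by (intro obs_square_le) auto
      also have "\<dots> \<le> real n * Hb\<^sup>2 * ?v" using i by (intro mult_left_mono sum_square_le_nsq) auto
      finally show "(obs i k (e k i) r)\<^sup>2 \<le> real n * Hb\<^sup>2 * ?v" .
    qed auto
    also have "\<dots> = ?Z * ?v" by (simp add: mult_ac)
    finally have Z: "(?b * (\<Sum>r<m i. ?h r * obs i k (e k i) r))\<^sup>2 \<le> ?Z * ?v" .
    have "inc k i l = (if l = k mod n then consensus k i else 0)
        + (?b * (\<Sum>r<m i. ?h r * w k i r) - ?b * (\<Sum>r<m i. ?h r * obs i k (e k i) r))"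
      unfolding inc_eq[OF i l] by (simp add: right_diff_distrib sum_subtractf)
    then have "(inc k i l)\<^sup>2 \<le> 3 * ((if l = k mod n then consensus k i else 0)\<^sup>2
        + (?b * (\<Sum>r<m i. ?h r * w k i r))\<^sup>2 + (?b * (\<Sum>r<m i. ?h r * obs i k (e k i) r))\<^sup>2)"
      using square_le_split3 by metis
    also have "\<dots> \<le> 3 * (?X + ?Y + ?Z * ?v)" by (intro mult_left_mono add_mono X Y Z) simp
    also have "\<dots> \<le> 3 * (?X + ?Y + ?Z) * (1 + ?v)"
    proof -
      have "3 * (X + Y + Z * v) \<le> 3 * (X + Y + Z) * (1 + v)" if "0 \<le> X" "0 \<le> Y" "0 \<le> Z" "0 \<le> v" for X Y Z v :: real
        using that mult_nonneg_nonneg[of X v] mult_nonneg_nonneg[of Y v] by (simp add: algebra_simps)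
      then show ?thesis by this (auto intro!: mult_nonneg_nonneg sum_nonneg nsq_nonneg)
    qed
    finally show "(inc k i l)\<^sup>2 \<le> 3 * (?X + ?Y + ?Z) * (1 + ?v)" .
  qed
  then show ?thesis unfolding perturbation_def by (simp only: sum_distrib_right)
qed

text \<open>Summing over the coordinates moves the transposed observation matrix onto the error,
  where it becomes \<open>obs\<close>. The innovation thus contributes minus a sum of squares, plus
  a term linear in the noise.\<close>

lemma cross_term:
  assumes i: "i \<in> {1..N}"
  shows "(\<Sum>l<n. 2 * (e k i l * inc k i l)) = 2 * (e k i (k mod n) * consensus k i)
    + 2 * (\<beta> i (Suc k) * (\<Sum>r<m i. obs i k (e k i) r * (w k i r - obs i k (e k i) r)))"
proof -
  have "(\<Sum>l<n. 2 * (e k i l * inc k i l)) = (\<Sum>l<n. 2 * (if l = k mod n then e k i l * consensus k i else 0)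
      + 2 * (\<beta> i (Suc k) * (\<Sum>r<m i. h i (Suc k) r l * e k i l * (w k i r - obs i k (e k i) r))))"
  proof (rule sum.cong)
    fix l assume "l \<in> {..<n}"
    then have l: "l < n" by simp
    show "2 * (e k i l * inc k i l) = 2 * (if l = k mod n then e k i l * consensus k i else 0)
      + 2 * (\<beta> i (Suc k) * (\<Sum>r<m i. h i (Suc k) r l * e k i l * (w k i r - obs i k (e k i) r)))"
      unfolding inc_eq[OF i l] by (simp add: distrib_left sum_distrib_left mult_ac)
  qed simp
  also have "\<dots> = 2 * (e k i (k mod n) * consensus k i)
      + 2 * (\<beta> i (Suc k) * (\<Sum>l<n. \<Sum>r<m i. h i (Suc k) r l * e k i l * (w k i r - obs i k (e k i) r)))"
    by (simp add: sum.distrib sum_distrib_left[symmetric] sum.delta)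
  also have "(\<Sum>l<n. \<Sum>r<m i. h i (Suc k) r l * e k i l * (w k i r - obs i k (e k i) r))
      = (\<Sum>r<m i. obs i k (e k i) r * (w k i r - obs i k (e k i) r))"
    unfolding obs_def[of i k "e k i"] by (subst sum.swap) (simp add: sum_distrib_right)
  finally show ?thesis .
qed

text \<open>Symmetry of the weights lets each edge be counted from both ends.\<close>

lemma consensus_cross_term:
  "(\<Sum>i\<in>{1..N}. 2 * (e k i (k mod n) * consensus k i))
    = (\<Sum>(i, j)\<in>edges N a. 2 * a i j * (\<alpha> i j (Suc k) * e k i (k mod n) * (s k i j - g k i j j)))
    - (\<Sum>(i, j)\<in>edges N a. \<alpha> i j (Suc k) * a i j * ((x k i - x k j) * (g k i j i - g k i j j)))"
proof -
  let ?e = "\<lambda>i. e k i (k mod n)" and ?A = "\<lambda>i j. \<alpha> i j (Suc k) * a i j"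
  \<comment> \<open>\<open>?T\<close> carries the uncentred part of the messages. Exchanging the
    ends of each edge gives a second expression for it, and the two expressions add up to minus the
    edge dissipation, the coordinate of \<open>\<theta>\<close> cancelling in
    \<open>x k i - x k j\<close>.\<close>
  let ?T = "\<Sum>(i, j)\<in>edges N a. ?A i j * (?e i * (g k i j j - g k i j i))"
  have "?T = (\<Sum>(i, j)\<in>edges N a. ?A j i * (?e j * (g k j i i - g k j i j)))"
    by (rule sum_edges_swap) (rule a_sym)
  also have "\<dots> = (\<Sum>(i, j)\<in>edges N a. ?A i j * (?e j * (g k i j i - g k i j j)))"
    by (rule sum.cong[OF refl], clarsimp) (metis \<alpha>_sym a_sym g_def Gfun_sym)
  finally have T: "?T = (\<Sum>(i, j)\<in>edges N a. ?A i j * (?e j * (g k i j i - g k i j j)))" .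
  have "(\<Sum>(i, j)\<in>edges N a. ?A i j * ((x k i - x k j) * (g k i j i - g k i j j)))
      = - ?T - (\<Sum>(i, j)\<in>edges N a. ?A i j * (?e j * (g k i j i - g k i j j)))"
    unfolding sum_negf[symmetric] sum_subtractf[symmetric] x_def
    by (rule sum.cong) (auto simp: algebra_simps)
  then have diss: "(\<Sum>(i, j)\<in>edges N a. ?A i j * ((x k i - x k j) * (g k i j i - g k i j j))) = - 2 * ?T"
    using T by simp
  have "(\<Sum>i\<in>{1..N}. 2 * (?e i * consensus k i))
      = (\<Sum>i\<in>{1..N}. \<Sum>j\<in>nbrs N a i. 2 * (?e i * (?A i j * (s k i j - g k i j i))))"
    unfolding consensus_def by (simp add: sum_distrib_left)
  also have "\<dots> = (\<Sum>(i, j)\<in>edges N a. 2 * (?e i * (?A i j * (s k i j - g k i j i))))"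
    by (rule sum_edges[symmetric])
  also have "\<dots> = (\<Sum>(i, j)\<in>edges N a. 2 * a i j * (\<alpha> i j (Suc k) * ?e i * (s k i j - g k i j j))) + 2 * ?T"
    unfolding sum_distrib_left sum.distrib[symmetric] by (rule sum.cong) (auto simp: algebra_simps)
  finally show ?thesis using diss by simp
qed

text \<open>In the expansion of the square of \<open>e + inc\<close> the linear term is exactly
  \<open>noise k - dissipation k\<close>; only the quadratic term is estimated.\<close>

lemma descent:
  "nsq (e (Suc k)) \<le> nsq (e k) - dissipation k + noise k + perturbation k * (1 + nsq (e k))"
proof -
  let ?O = "\<lambda>i r. obs i k (e k i) r"
  have "nsq (e (Suc k)) = (\<Sum>i\<in>{1..N}. \<Sum>l<n. (e k i l)\<^sup>2 + 2 * (e k i l * inc k i l) + (inc k i l)\<^sup>2)"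
    unfolding nsq_def inc_def by (intro sum.cong refl) (simp add: power2_eq_square algebra_simps)
  also have "\<dots> = nsq (e k) + (\<Sum>i\<in>{1..N}. \<Sum>l<n. 2 * (e k i l * inc k i l)) + nsq (inc k)"
    unfolding nsq_def by (simp only: sum.distrib)
  also have "(\<Sum>i\<in>{1..N}. \<Sum>l<n. 2 * (e k i l * inc k i l))
      = (\<Sum>i\<in>{1..N}. 2 * (e k i (k mod n) * consensus k i))
      + (\<Sum>i\<in>{1..N}. 2 * (\<beta> i (Suc k) * (\<Sum>r<m i. ?O i r * (w k i r - ?O i r))))"
    by (simp add: cross_term sum.distrib)
  also have "(\<Sum>i\<in>{1..N}. 2 * (\<beta> i (Suc k) * (\<Sum>r<m i. ?O i r * (w k i r - ?O i r))))
      = (\<Sum>i\<in>{1..N}. \<Sum>r<m i. 2 * (\<beta> i (Suc k) * ?O i r * w k i r))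
      - 2 * (\<Sum>i\<in>{1..N}. \<beta> i (Suc k) * (\<Sum>r<m i. (?O i r)\<^sup>2))"
    unfolding sum_distrib_left sum_subtractf[symmetric]
    by (intro sum.cong refl) (simp add: power2_eq_square algebra_simps)
  finally show ?thesis
    using nsq_inc_le[of k] unfolding consensus_cross_term dissipation_def noise_def by linarith
qed

text \<open>A common bound \<open>R\<close> makes the slope constants of
  \<open>Gfun_increment\<close> independent of time, and finitely many edges leave a positive
  minimum. The factor \<open>z k\<close> then lies below the damped consensus gains and below the
  observation gains.\<close>

lemma dissipation_lower:
  assumes R: "\<And>k i. i \<in> {1..N} \<Longrightarrow> \<bar>x k i\<bar> \<le> R"
  obtains c0 where "0 < c0" and "\<And>k. c0 * (z k * energy k (e k)) \<le> dissipation k"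
proof -
  define \<gamma> where "\<gamma> = (\<lambda>(i, j). exp (- R / b i j) / (2 * b i j))"
  \<comment> \<open>The element \<open>1\<close> keeps the set nonempty and gives
    \<open>c0 \<le> 1\<close>, which is what the observation part requires.\<close>
  define c0 where "c0 = Min (insert 1 (\<gamma> ` edges N a))"
  have c0: "0 < c0" "c0 \<le> 1" "\<And>i j. (i, j) \<in> edges N a \<Longrightarrow> c0 \<le> exp (- R / b i j) / (2 * b i j)"
  proof -
    have fin: "finite (insert 1 (\<gamma> ` edges N a))" using finite_edges by auto
    show "0 < c0" unfolding c0_def using fin b_pos by (subst Min_gr_iff) (auto simp: \<gamma>_def)
    show "c0 \<le> 1" unfolding c0_def using fin by (intro Min_le) auto
    fix i j assume "(i, j) \<in> edges N a"
    then have "c0 \<le> \<gamma> (i, j)" unfolding c0_def using fin by (intro Min_le) auto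
    then show "c0 \<le> exp (- R / b i j) / (2 * b i j)" by (simp add: \<gamma>_def)
  qed
  have "c0 * (z k * energy k (e k)) \<le> dissipation k" for k
  proof -
    have "(\<Sum>(i, j)\<in>edges N a. c0 * (z k * (a i j * (e k i (k mod n) - e k j (k mod n))\<^sup>2)))
        \<le> (\<Sum>(i, j)\<in>edges N a. \<alpha> i j (Suc k) * a i j * ((x k i - x k j) * (g k i j i - g k i j j)))"
    proof (rule sum_mono, clarsimp)
      fix i j assume ij: "(i, j) \<in> edges N a"
      then have iN: "i \<in> {1..N}" "j \<in> {1..N}" by (auto simp: edges_def)
      let ?d = "(x k i - x k j)\<^sup>2" and ?K = "real (Suc k) powr \<nu> i j"
      let ?\<gamma> = "exp (- R / b i j) / (2 * b i j)"
      have "z k * c0 \<le> (\<alpha> i j (Suc k) / ?K) * ?\<gamma>"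
        using z_le_\<alpha>[OF ij, of k] c0(3)[OF ij] z_nonneg[of k] c0(1) \<alpha>_pos[OF ij, of k] by (intro mult_mono) auto
      then have "(z k * c0) * (a i j * ?d) \<le> ((\<alpha> i j (Suc k) / ?K) * ?\<gamma>) * (a i j * ?d)"
        using a_pos[OF ij] by (intro mult_right_mono) auto
      also have "\<dots> = \<alpha> i j (Suc k) * a i j * (?\<gamma> * ?d / ?K)" by (simp add: mult_ac)
      also have "\<dots> \<le> \<alpha> i j (Suc k) * a i j * ((x k i - x k j) * (g k i j i - g k i j j))"
        unfolding g_def using \<alpha>_pos[OF ij, of k] a_pos[OF ij] b_pos[OF ij] \<nu>_nonneg[OF ij] R iN
        by (intro mult_left_mono Gfun_increment) auto
      finally show "c0 * (z k * (a i j * (e k i (k mod n) - e k j (k mod n))\<^sup>2))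
          \<le> \<alpha> i j (Suc k) * a i j * ((x k i - x k j) * (g k i j i - g k i j j))"
        unfolding x_def by (simp add: mult_ac)
    qed
    moreover have "c0 * (z k * (\<Sum>i\<in>{1..N}. \<Sum>r<m i. (obs i k (e k i) r)\<^sup>2))
        \<le> 2 * (\<Sum>i\<in>{1..N}. \<beta> i (Suc k) * (\<Sum>r<m i. (obs i k (e k i) r)\<^sup>2))"
    proof -
      have "c0 * (z k * (\<Sum>i\<in>{1..N}. \<Sum>r<m i. (obs i k (e k i) r)\<^sup>2))
          = (\<Sum>i\<in>{1..N}. c0 * z k * (\<Sum>r<m i. (obs i k (e k i) r)\<^sup>2))"
        by (simp add: sum_distrib_left mult.assoc)
      also have "\<dots> \<le> (\<Sum>i\<in>{1..N}. 2 * \<beta> i (Suc k) * (\<Sum>r<m i. (obs i k (e k i) r)\<^sup>2))"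
      proof (intro sum_mono mult_right_mono sum_nonneg)
        fix i assume i: "i \<in> {1..N}"
        have "c0 * z k \<le> 1 * \<beta> i (Suc k)"
          using c0 z_nonneg z_le_\<beta>[OF i] by (intro mult_mono) auto
        then show "c0 * z k \<le> 2 * \<beta> i (Suc k)" using \<beta>_pos[OF i, of k] by simp
      qed auto
      finally show ?thesis by (simp add: sum_distrib_left mult.assoc)
    qed
    ultimately show ?thesis
      unfolding energy_def dissipation_def
      by (simp add: distrib_left sum_distrib_left case_prod_unfold)
  qed
  then show thesis using that c0(1) by blast
qed

text \<open>This enters before any bound on the path is known, so \<open>Gfun_increment\<close> is
  applied with the larger of the two current moduli in place of \<open>R\<close>.\<close>

lemma dissipation_nonneg: "0 \<le> dissipation k"
proof -
  have "0 \<le> (x k i - x k j) * (g k i j i - g k i j j)" if ij: "(i, j) \<in> edges N a" for i j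
  proof (rule order_trans)
    show "exp (- max \<bar>x k i\<bar> \<bar>x k j\<bar> / b i j) / (2 * b i j) * (x k i - x k j)\<^sup>2 / real (Suc k) powr \<nu> i j
      \<le> (x k i - x k j) * (g k i j i - g k i j j)"
      unfolding g_def using b_pos[OF ij] \<nu>_nonneg[OF ij] by (intro Gfun_increment) auto
  qed (use b_pos[OF ij] in simp)
  then have "0 \<le> (\<Sum>(i, j)\<in>edges N a. \<alpha> i j (Suc k) * a i j * ((x k i - x k j) * (g k i j i - g k i j j)))"
    using \<alpha>_pos a_pos by (intro sum_nonneg) (force intro: mult_nonneg_nonneg simp: less_imp_le)
  moreover have "0 \<le> (\<Sum>i\<in>{1..N}. \<beta> i (Suc k) * (\<Sum>r<m i. (obs i k (e k i) r)\<^sup>2))"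
    using \<beta>_pos by (intro sum_nonneg mult_nonneg_nonneg) (auto simp: less_imp_le)
  ultimately show ?thesis unfolding dissipation_def by simp
qed

lemma summable_noise: "summable (\<lambda>k. noise k / (1 + nsq (e k)))"
proof -
  have "summable (\<lambda>k. (\<Sum>(i, j)\<in>edges N a. 2 * a i j * (\<alpha> i j (Suc k) * (e k i (k mod n) / (1 + nsq (e k))) * (s k i j - g k i j j)))
    + (\<Sum>i\<in>{1..N}. \<Sum>r<m i. 2 * (\<beta> i (Suc k) * (obs i k (e k i) r / (1 + nsq (e k))) * w k i r)))"
    unfolding g_def x_def case_prod_unfold
    using dither_noise obs_noise by (intro summable_add summable_sum summable_mult) auto
  then show ?thesis
    unfolding noise_def by (simp add: add_divide_distrib sum_divide_distrib case_prod_unfold)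
qed

theorem nsq_tendsto_0: "(\<lambda>k. nsq (e k)) \<longlonglongrightarrow> 0"
proof -
  have conv: "convergent (\<lambda>k. nsq (e k))" and sumD: "summable dissipation"
    using perturbed_descent_converges[of "\<lambda>k. nsq (e k)" dissipation perturbation noise,
        OF nsq_nonneg dissipation_nonneg summable_perturbation summable_noise descent] by simp_all
  obtain v where v: "(\<lambda>k. nsq (e k)) \<longlonglongrightarrow> v" using conv by (auto simp: convergent_def)
  obtain B where B: "\<And>k. nsq (e k) \<le> B"
    using convergent_imp_Bseq[OF conv] unfolding Bseq_def by (auto simp: abs_le_iff)
  have R: "\<bar>x k i\<bar> \<le> (\<Sum>l<n. \<bar>\<theta> l\<bar>) + (1 + B)" if "i \<in> {1..N}" for k i
  proof -
    have "\<bar>\<theta> (k mod n)\<bar> \<le> (\<Sum>l<n. \<bar>\<theta> l\<bar>)" by (rule member_le_sum) auto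
    moreover have "\<bar>e k i (k mod n)\<bar> \<le> 1 + B"
      using abs_le_one_plus_square[of "e k i (k mod n)"] square_le_nsq[OF that q_less, of "e k" k] B[of k] by linarith
    ultimately show ?thesis unfolding x_def by linarith
  qed
  obtain c0 where c0: "0 < c0" "\<And>k. c0 * (z k * energy k (e k)) \<le> dissipation k"
    using dissipation_lower[OF R] by blast
  obtain C where C: "0 \<le> C" "\<And>k f. energy k f \<le> C * nsq f" using energy_le by blast
  obtain K where K: "0 < K" "\<And>k f. nsq f \<le> K * (\<Sum>t<n + p. energy (k + t) f)"
    using nsq_le_window_energy by blast
  \<comment> \<open>Squared increments are at most a null sequence times a convergent one. Hence
    single increments vanish, and so does the drift over a window of fixed length.\<close>
  have inc0: "(\<lambda>k. inc k i l) \<longlonglongrightarrow> 0" if "i \<in> {1..N}" "l < n" for i l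
  proof -
    have "(\<lambda>k. perturbation k * (1 + nsq (e k))) \<longlonglongrightarrow> 0 * (1 + v)"
      using summable_LIMSEQ_zero[OF summable_perturbation] v by (intro tendsto_intros)
    then have "(\<lambda>k. perturbation k * (1 + nsq (e k))) \<longlonglongrightarrow> 0" by simp
    then have "(\<lambda>k. (inc k i l)\<^sup>2) \<longlonglongrightarrow> 0"
      by (rule tendsto_sandwich[OF _ _ tendsto_const, rotated 2])
        (use order_trans[OF square_le_nsq[OF that] nsq_inc_le] in \<open>auto intro!: always_eventually\<close>)
    then show ?thesis by simp
  qed
  have drift: "(\<lambda>k. e k i l - e (k + t) i l) \<longlonglongrightarrow> 0" if "i \<in> {1..N}" "l < n" for i l t
  proof -
    have "(\<lambda>k. \<Sum>u<t. - inc (k + u) i l) \<longlonglongrightarrow> (\<Sum>u<t. - 0)"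
      by (intro tendsto_sum tendsto_minus LIMSEQ_ignore_initial_segment inc0[OF that])
    moreover have "(\<Sum>u<t. - inc (k + u) i l) = e k i l - e (k + t) i l" for k
      by (induction t) (auto simp: inc_def)
    ultimately show ?thesis by simp
  qed
  \<comment> \<open>The cost of freezing the error at the start of the window: the \<open>2\<close>
    is that of \<open>energy_split\<close>, and \<open>C\<close> that of
    \<open>energy_le\<close>.\<close>
  define \<epsilon> where "\<epsilon> k = K * (\<Sum>t<n + p. 2 * (C * nsq (\<lambda>i l. e k i l - e (k + t) i l)))" for k
  have "\<epsilon> \<longlonglongrightarrow> K * (\<Sum>t<n + p. 2 * (C * (\<Sum>i\<in>{1..N}. \<Sum>l<n. 0\<^sup>2)))"
    unfolding \<epsilon>_def nsq_def by (intro tendsto_intros drift) auto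
  then have \<epsilon>: "\<epsilon> \<longlonglongrightarrow> 0" by simp
  have window: "nsq (e k) \<le> (2 * K) * (\<Sum>t<n + p. energy (k + t) (e (k + t))) + \<epsilon> k" for k
  proof -
    have "nsq (e k) \<le> K * (\<Sum>t<n + p. energy (k + t) (e k))" by (rule K)
    also have "\<dots> \<le> K * (\<Sum>t<n + p. 2 * energy (k + t) (e (k + t)) + 2 * (C * nsq (\<lambda>i l. e k i l - e (k + t) i l)))"
    proof (intro mult_left_mono sum_mono)
      fix t
      show "energy (k + t) (e k) \<le> 2 * energy (k + t) (e (k + t)) + 2 * (C * nsq (\<lambda>i l. e k i l - e (k + t) i l))"
        using energy_split[of "k + t" "e k" "e (k + t)"] C(2)[of "k + t" "\<lambda>i l. e k i l - e (k + t) i l"] by linarith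
    qed (use K in simp)
    also have "\<dots> = (2 * K) * (\<Sum>t<n + p. energy (k + t) (e (k + t))) + \<epsilon> k"
      unfolding \<epsilon>_def by (simp add: sum.distrib sum_distrib_left[symmetric] distrib_left)
    finally show ?thesis .
  qed
  show ?thesis
    by (rule descent_limit_zero[OF conv nsq_nonneg sumD c0(2,1) energy_nonneg z_nonneg z_ratio
          z_not_summable c_ge_1 window _ \<epsilon>]) (use K in simp)
qed

end

section \<open>Almost sure convergence\<close>

lemma space_sigma_fun [simp]: "space (sigma_fun M S) = space M"
  unfolding sigma_fun_def by (intro space_measure_of) auto

lemma sets_sigma_fun:
  "sets (sigma_fun M S) = sigma_sets (space M) {f -` A \<inter> space M | f A. f \<in> S \<and> A \<in> sets borel}"
  unfolding sigma_fun_def by (intro sets_measure_of) auto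

lemma measurable_sigma_fun: "f \<in> S \<Longrightarrow> f \<in> borel_measurable (sigma_fun M S)"
  by (intro measurableI) (auto simp: sets_sigma_fun)

lemma subalgebra_sigma_fun:
  assumes "\<And>f. f \<in> S \<Longrightarrow> f \<in> borel_measurable M"
  shows "subalgebra M (sigma_fun M S)"
  unfolding subalgebra_def sets_sigma_fun
  using assms by (auto intro!: sets.sigma_sets_subset measurable_sets)

lemma subalgebra_sigma_fun_mono: "S \<subseteq> T \<Longrightarrow> subalgebra (sigma_fun M T) (sigma_fun M S)"
  unfolding subalgebra_def sets_sigma_fun by (auto intro!: sigma_sets_mono')

text \<open>Fubini for the product law of the pair: with \<open>Y\<close> fixed at \<open>y\<close>,
  the inner integral over the law of \<open>D\<close> vanishes. This takes the place of conditioning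
  on the past.\<close>

lemma (in prob_space) integral_indep_eq_0:
  fixes f :: "'b \<Rightarrow> 'b \<Rightarrow> real"
  assumes ind: "indep_var S Y T D"
    and f [measurable]: "case_prod f \<in> borel_measurable (S \<Otimes>\<^sub>M T)"
    and int: "integrable M (\<lambda>x. f (Y x) (D x))"
    and zero: "\<And>y. y \<in> space S \<Longrightarrow> (\<integral>x. f y (D x) \<partial>M) = 0"
  shows "(\<integral>x. f (Y x) (D x) \<partial>M) = 0"
proof -
  have [measurable]: "Y \<in> measurable M S" "D \<in> measurable M T"
    using indep_var_rv1[OF ind] indep_var_rv2[OF ind] .
  interpret Y: prob_space "distr M S Y" by (rule prob_space_distr) simp
  interpret D: prob_space "distr M T D" by (rule prob_space_distr) simp
  interpret YD: pair_prob_space "distr M S Y" "distr M T D" ..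
  have eq: "distr M S Y \<Otimes>\<^sub>M distr M T D = distr M (S \<Otimes>\<^sub>M T) (\<lambda>x. (Y x, D x))"
    using ind unfolding indep_var_distribution_eq by blast
  have int2: "integrable (distr M S Y \<Otimes>\<^sub>M distr M T D) (case_prod f)"
    unfolding eq by (subst integrable_distr_eq) (use int in auto)
  have "(\<integral>x. f (Y x) (D x) \<partial>M) = (\<integral>q. case_prod f q \<partial>distr M (S \<Otimes>\<^sub>M T) (\<lambda>x. (Y x, D x)))"
    by (subst integral_distr) auto
  also have "\<dots> = (\<integral>y. \<integral>t. case_prod f (y, t) \<partial>distr M T D \<partial>distr M S Y)"
    unfolding eq[symmetric] by (rule YD.integral_fst'[symmetric, OF int2])
  also have "\<dots> = (\<integral>y. 0 \<partial>distr M S Y)"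
  proof (rule Bochner_Integration.integral_cong)
    fix y assume "y \<in> space (distr M S Y)"
    then have y: "y \<in> space S" by simp
    then have "f y \<in> borel_measurable T" using measurable_Pair2[OF f, of y] by simp
    then show "(\<integral>t. case_prod f (y, t) \<partial>distr M T D) = 0" using zero[OF y] by (simp add: integral_distr)
  qed simp
  also have "\<dots> = 0" by simp
  finally show ?thesis .
qed

text \<open>Integrating out the fresh dither leaves \<open>Gfun\<close> at the sender's value, so
  the bracket is centred given the past. The weights \<open>u\<close> are predictable and bounded,
  hence the second moments are dominated by a constant times the square of
  \<open>\<alpha> k\<close>.\<close>

lemma (in prob_space) dither_noise_AE_summable:
  fixes D x u :: "nat \<Rightarrow> 'a \<Rightarrow> real"
  assumes subalg: "\<And>k. subalgebra M (F k)" and filtration: "\<And>k. subalgebra (F (Suc k)) (F k)"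
    and D: "\<And>k. D k \<in> borel_measurable (F (Suc k))"
    and lap: "\<And>k. distributed M lborel (D k) (\<lambda>t. ennreal (exp (- \<bar>t\<bar>) / 2))"
    and ind: "\<And>k. indep_set (sets (F k)) (sets (sigma_fun M {D k}))"
    and x: "\<And>k. x k \<in> borel_measurable (F k)" and u: "\<And>k. u k \<in> borel_measurable (F k)"
    and u_le: "\<And>k \<omega>. \<bar>u k \<omega>\<bar> \<le> B"
    and b: "0 < b j i" and \<nu>: "0 \<le> \<nu> j i" and \<alpha>: "summable (\<lambda>k. (\<alpha> k)\<^sup>2)"
  shows "AE \<omega> in M. summable (\<lambda>k. \<alpha> k * u k \<omega>
    * (recv \<nu> b j i (Suc k) (x k \<omega>) (D k \<omega>) - Gfun \<nu> b j i (Suc k) (x k \<omega>)))"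
proof -
  define r where "r k y t = recv \<nu> b j i (Suc k) y t - Gfun \<nu> b j i (Suc k) y" for k y t
  define X where "X k \<omega> = \<alpha> k * u k \<omega> * r k (x k \<omega>) (D k \<omega>)" for k \<omega>
  have [measurable]: "case_prod (r k) \<in> borel_measurable (borel \<Otimes>\<^sub>M borel)" for k
    unfolding r_def by measurable
  have r_le: "\<bar>r k y t\<bar> \<le> 2" for k y t
    unfolding r_def using abs_recv_le[of \<nu> b j i "Suc k" y t] abs_Gfun_le[of \<nu> b j i "Suc k" y] by linarith
  have B0: "0 \<le> B" using u_le[of 0 undefined] by linarith
  have [measurable]: "D k \<in> borel_measurable M" "x k \<in> borel_measurable M" "u k \<in> borel_measurable M" for k
    by (rule measurable_from_subalg[OF subalg D] measurable_from_subalg[OF subalg x]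
        measurable_from_subalg[OF subalg u])+
  have X_F: "X k \<in> borel_measurable (F (Suc k))" for k
  proof -
    have [measurable]: "x k \<in> borel_measurable (F (Suc k))" "u k \<in> borel_measurable (F (Suc k))"
      "D k \<in> borel_measurable (F (Suc k))"
      by (rule D measurable_from_subalg[OF filtration x] measurable_from_subalg[OF filtration u])+
    show ?thesis unfolding X_def by measurable
  qed
  then have [measurable]: "X k \<in> borel_measurable M" for k by (rule measurable_from_subalg[OF subalg])
  have X_le: "\<bar>X k \<omega>\<bar> \<le> \<bar>\<alpha> k\<bar> * (2 * B)" for k \<omega>
  proof -
    have "\<bar>u k \<omega>\<bar> * \<bar>r k (x k \<omega>) (D k \<omega>)\<bar> \<le> B * 2" using u_le r_le B0 by (intro mult_mono) auto
    then show ?thesis unfolding X_def abs_mult mult.assoc by (intro mult_left_mono) auto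
  qed
  then have X2_le: "(X k \<omega>)\<^sup>2 \<le> (2 * B)\<^sup>2 * (\<alpha> k)\<^sup>2" for k \<omega>
    using power_mono[OF X_le, of k \<omega> 2] by (simp add: power_mult_distrib mult_ac)
  have X2: "integrable M (\<lambda>\<omega>. (X k \<omega>)\<^sup>2)" for k
    by (rule integrable_const_bound[of _ "(2 * B)\<^sup>2 * (\<alpha> k)\<^sup>2"]) (use X2_le in auto)
  interpret square_integrable_martingale_differences M F X
  proof
    fix k h H assume h: "h \<in> borel_measurable (F k)" and h_le: "\<And>\<omega>. \<bar>h \<omega>\<bar> \<le> (H::real)"
    \<comment> \<open>The test function is merged with the weight, so that one use of independence
      handles everything that depends on the past.\<close>
    define Y where "Y \<omega> = (h \<omega> * u k \<omega>, x k \<omega>)" for \<omega>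
    have YF: "Y \<in> measurable (F k) (borel \<Otimes>\<^sub>M borel)"
      unfolding Y_def using h x[of k] u[of k] by measurable
    have [measurable]: "Y \<in> measurable M (borel \<Otimes>\<^sub>M borel)" "h \<in> borel_measurable M"
      by (rule measurable_from_subalg[OF subalg YF] measurable_from_subalg[OF subalg h])+
    have space_F: "space (F k) = space M" using subalg by (simp add: subalgebra_def)
    \<comment> \<open>The pairing with \<open>0\<close> is only there because \<open>indep_var\<close> needs both variables in one type.\<close>
    have "indep_var (borel \<Otimes>\<^sub>M borel) Y (borel \<Otimes>\<^sub>M borel) (\<lambda>\<omega>. (D k \<omega>, 0::real))"
      unfolding indep_var_eq
    proof (intro conjI)
      have 1: "sigma_sets (space M) {Y -` A \<inter> space M |A. A \<in> sets (borel \<Otimes>\<^sub>M borel)} \<subseteq> sets (F k)"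
        unfolding space_F[symmetric] using measurable_sets[OF YF]
        by (intro sets.sigma_sets_subset) auto
      have [measurable]: "D k \<in> borel_measurable (sigma_fun M {D k})" by (rule measurable_sigma_fun) simp
      have "(\<lambda>\<omega>. (D k \<omega>, 0::real)) \<in> measurable (sigma_fun M {D k}) (borel \<Otimes>\<^sub>M borel)" by measurable
      from measurable_sets[OF this]
      have 2: "sigma_sets (space M) {(\<lambda>\<omega>. (D k \<omega>, 0::real)) -` A \<inter> space M |A. A \<in> sets (borel \<Otimes>\<^sub>M borel)}
          \<subseteq> sets (sigma_fun M {D k})"
        unfolding space_sigma_fun[of M "{D k}", symmetric] by (intro sets.sigma_sets_subset) auto
      show "indep_set (sigma_sets (space M) {Y -` A \<inter> space M |A. A \<in> sets (borel \<Otimes>\<^sub>M borel)})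
          (sigma_sets (space M) {(\<lambda>\<omega>. (D k \<omega>, 0::real)) -` A \<inter> space M |A. A \<in> sets (borel \<Otimes>\<^sub>M borel)})"
        using ind[of k] 1 2 unfolding indep_sets2_eq by blast
    qed measurable
    then have "(\<integral>\<omega>. (\<lambda>y t. fst y * r k (snd y) (fst t)) (Y \<omega>) ((\<lambda>\<omega>. (D k \<omega>, 0::real)) \<omega>) \<partial>M) = 0"
    proof (rule integral_indep_eq_0)
      have "\<bar>fst (Y \<omega>) * r k (snd (Y \<omega>)) (D k \<omega>)\<bar> \<le> (\<bar>H\<bar> * B) * 2" for \<omega>
        unfolding Y_def abs_mult fst_conv snd_conv
        using u_le r_le B0 h_le[of \<omega>] by (intro mult_mono) auto
      then show "integrable M (\<lambda>\<omega>. fst (Y \<omega>) * r k (snd (Y \<omega>)) (fst (D k \<omega>, 0::real)))"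
        by (intro integrable_const_bound[of _ "(\<bar>H\<bar> * B) * 2"]) auto
      fix y :: "real \<times> real"
      have "integrable M (\<lambda>\<omega>. recv \<nu> b j i (Suc k) (snd y) (D k \<omega>))"
        by (intro integrable_const_bound[of _ 1]) (auto simp: abs_recv_le)
      moreover have "(\<integral>\<omega>. recv \<nu> b j i (Suc k) (snd y) (D k \<omega>) \<partial>M) = Gfun \<nu> b j i (Suc k) (snd y)"
        using integral_recv[of "D k" b j i \<nu> "Suc k" "snd y", OF lap b thr_nonneg] \<nu> b
        by (simp add: integral_distr)
      ultimately show "(\<integral>\<omega>. fst y * r k (snd y) (fst (D k \<omega>, 0::real)) \<partial>M) = 0"
        unfolding r_def by (simp add: prob_space)
    qed measurable
    then have "\<alpha> k * (\<integral>\<omega>. h \<omega> * u k \<omega> * r k (x k \<omega>) (D k \<omega>) \<partial>M) = 0"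
      unfolding Y_def by simp
    then show "(\<integral>\<omega>. h \<omega> * X k \<omega> \<partial>M) = 0"
      unfolding X_def integral_mult_right_zero[symmetric] by (simp add: mult_ac)
  qed (use subalg filtration X_F X2 in auto)
  have "summable (\<lambda>k. \<integral>\<omega>. (X k \<omega>)\<^sup>2 \<partial>M)"
  proof (rule summable_comparison_test'[OF summable_mult[OF \<alpha>, of "(2 * B)\<^sup>2"]])
    fix k
    have "(\<integral>\<omega>. (X k \<omega>)\<^sup>2 \<partial>M) \<le> (\<integral>\<omega>. (2 * B)\<^sup>2 * (\<alpha> k)\<^sup>2 \<partial>M)"
      by (rule integral_mono) (use X2 X2_le in auto)
    then show "norm (\<integral>\<omega>. (X k \<omega>)\<^sup>2 \<partial>M) \<le> (2 * B)\<^sup>2 * (\<alpha> k)\<^sup>2" by (simp add: prob_space)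
  qed
  then show ?thesis using AE_summable unfolding X_def r_def by blast
qed

text \<open>The conditional moments are bounded by a random constant only, so the noise is truncated by the
  predictable events on which they are at most \<open>K\<close>.\<close>

lemma (in prob_space) obs_noise_AE_summable:
  fixes w u :: "nat \<Rightarrow> 'a \<Rightarrow> real" and f :: "nat \<Rightarrow> 'a \<Rightarrow> ennreal"
  assumes subalg: "\<And>k. subalgebra M (F k)" and filtration: "\<And>k. subalgebra (F (Suc k)) (F k)"
    and subG: "\<And>k. subalgebra (F k) (G k)"
    and w: "\<And>k. w k \<in> borel_measurable (F (Suc k))" and w_int: "\<And>k. integrable M (w k)"
    and mds: "\<And>k. AE \<omega> in M. real_cond_exp M (F k) (w k) \<omega> = 0"
    and f [measurable]: "\<And>k. f k \<in> borel_measurable M" and f_ge: "\<And>k \<omega>. ennreal ((w k \<omega>)\<^sup>2) \<le> 1 + f k \<omega>"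
    and bdd: "AE \<omega> in M. (\<Squnion>k. nn_cond_exp M (G k) (f k) \<omega>) < \<infinity>"
    and u: "\<And>k. u k \<in> borel_measurable (F k)" and u_le: "\<And>k \<omega>. \<bar>u k \<omega>\<bar> \<le> B"
    and \<beta>: "summable (\<lambda>k. (\<beta> k)\<^sup>2)"
  shows "AE \<omega> in M. summable (\<lambda>k. \<beta> k * u k \<omega> * w k \<omega>)"
    and "AE \<omega> in M. summable (\<lambda>k. (\<beta> k)\<^sup>2 * (w k \<omega>)\<^sup>2)"
proof -
  have B0: "0 \<le> B" using u_le[of 0 undefined] by linarith
  have [measurable]: "w k \<in> borel_measurable M" "u k \<in> borel_measurable M" for k
    by (rule measurable_from_subalg[OF subalg w] measurable_from_subalg[OF subalg u])+
  have subMG: "subalgebra M (G k)" for k using subalg[of k] subG[of k] by (auto simp: subalgebra_def)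
  define A where "A K k = {\<omega> \<in> space M. nn_cond_exp M (G k) (f k) \<omega> \<le> of_nat K}" for K k :: nat
  have AG: "A K k \<in> sets (G k)" for K k
  proof -
    have sp: "space M = space (G k)" using subMG[of k] by (simp add: subalgebra_def)
    show ?thesis unfolding A_def sp by measurable
  qed
  have AF: "A K k \<in> sets (F k)" and AM [measurable]: "A K k \<in> sets M" for K k
    using AG[of K k] subG[of k] subalg[of k] by (auto simp: subalgebra_def)
  define y where "y K k \<omega> = indicator (A K k) \<omega> * w k \<omega>" for K k \<omega>
  have [measurable]: "y K k \<in> borel_measurable M" for K k unfolding y_def by measurable
  \<comment> \<open>The truncating event belongs to \<open>G k\<close>, so under the integral
    \<open>f k\<close> may be replaced by its conditional expectation, which is at most
    \<open>K\<close> on that event. The \<open>1\<close> stems from \<open>f_ge\<close>.\<close>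
  have y2: "(\<integral>\<^sup>+\<omega>. ennreal ((y K k \<omega>)\<^sup>2) \<partial>M) \<le> ennreal (1 + real K)" for K k
  proof -
    interpret G: finite_measure_subalgebra M "G k" using subMG by unfold_locales
    have "(\<integral>\<^sup>+\<omega>. ennreal ((y K k \<omega>)\<^sup>2) \<partial>M) \<le> (\<integral>\<^sup>+\<omega>. indicator (A K k) \<omega> + indicator (A K k) \<omega> * f k \<omega> \<partial>M)"
      using f_ge by (intro nn_integral_mono) (auto simp: y_def split: split_indicator)
    also have "\<dots> = (\<integral>\<^sup>+\<omega>. indicator (A K k) \<omega> \<partial>M) + (\<integral>\<^sup>+\<omega>. indicator (A K k) \<omega> * nn_cond_exp M (G k) (f k) \<omega> \<partial>M)"
      using AG by (subst G.nn_cond_exp_intg) (auto simp: nn_integral_add)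
    also have "\<dots> \<le> (\<integral>\<^sup>+\<omega>. 1 \<partial>M) + (\<integral>\<^sup>+\<omega>. of_nat K \<partial>M)"
      by (intro add_mono nn_integral_mono) (auto simp: A_def split: split_indicator)
    also have "\<dots> = ennreal (1 + real K)" by (simp add: emeasure_space_1 ennreal_of_nat_eq_real_of_nat)
    finally show ?thesis .
  qed
  have y2_int: "integrable M (\<lambda>\<omega>. (y K k \<omega>)\<^sup>2)" and y2_le: "(\<integral>\<omega>. (y K k \<omega>)\<^sup>2 \<partial>M) \<le> 1 + real K" for K k
  proof -
    show "integrable M (\<lambda>\<omega>. (y K k \<omega>)\<^sup>2)"
      using le_less_trans[OF y2[of K k]] by (intro integrableI_bounded) auto
    then have "ennreal (\<integral>\<omega>. (y K k \<omega>)\<^sup>2 \<partial>M) \<le> ennreal (1 + real K)"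
      using y2[of K k] nn_integral_eq_integral[of M "\<lambda>\<omega>. (y K k \<omega>)\<^sup>2"] by simp
    then show "(\<integral>\<omega>. (y K k \<omega>)\<^sup>2 \<partial>M) \<le> 1 + real K"
      by (subst (asm) ennreal_le_iff) auto
  qed
  have AE1: "AE \<omega> in M. summable (\<lambda>k. \<beta> k * u k \<omega> * y K k \<omega>)" for K
  proof -
    define X where "X k \<omega> = \<beta> k * u k \<omega> * y K k \<omega>" for k \<omega>
    have [measurable]: "X k \<in> borel_measurable M" for k unfolding X_def by measurable
    have X2_le: "(X k \<omega>)\<^sup>2 \<le> (B\<^sup>2 * (\<beta> k)\<^sup>2) * (y K k \<omega>)\<^sup>2" for k \<omega>
    proof -
      have "(u k \<omega>)\<^sup>2 \<le> B\<^sup>2" using u_le[of k \<omega>] B0 by (simp add: abs_le_square_iff[symmetric])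
      then have "(\<beta> k)\<^sup>2 * ((u k \<omega>)\<^sup>2 * (y K k \<omega>)\<^sup>2) \<le> (\<beta> k)\<^sup>2 * (B\<^sup>2 * (y K k \<omega>)\<^sup>2)"
        by (intro mult_left_mono mult_right_mono) auto
      then show ?thesis unfolding X_def by (simp add: power_mult_distrib mult_ac)
    qed
    have X2: "integrable M (\<lambda>\<omega>. (X k \<omega>)\<^sup>2)" for k
      by (rule Bochner_Integration.integrable_bound[OF integrable_mult_right[OF y2_int, of "B\<^sup>2 * (\<beta> k)\<^sup>2" K k]])
        (use X2_le in auto)
    interpret square_integrable_martingale_differences M F X
    proof
      fix k
      have [measurable]: "w k \<in> borel_measurable (F (Suc k))" "u k \<in> borel_measurable (F (Suc k))"
        "A K k \<in> sets (F (Suc k))"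
        using measurable_from_subalg[OF filtration u] w AF[of K k] filtration[of k] by (auto simp: subalgebra_def)
      show "X k \<in> borel_measurable (F (Suc k))" unfolding X_def y_def by measurable
      fix h H assume h: "h \<in> borel_measurable (F k)" and h_le: "\<And>\<omega>. \<bar>h \<omega>\<bar> \<le> (H::real)"
      interpret Fk: finite_measure_subalgebra M "F k" using subalg by unfold_locales
      \<comment> \<open>All factors except \<open>w k\<close> are bounded and
        \<open>F k\<close>-measurable, the truncation included; so \<open>w k\<close> may be
        replaced by its conditional expectation, which is \<open>0\<close>.\<close>
      define v where "v \<omega> = h \<omega> * (\<beta> k * u k \<omega> * indicator (A K k) \<omega>)" for \<omega>
      have vF: "v \<in> borel_measurable (F k)" unfolding v_def using h u[of k] AF[of K k] by measurable
      then have [measurable]: "v \<in> borel_measurable M" by (rule measurable_from_subalg[OF subalg])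
      have "\<bar>v \<omega>\<bar> \<le> \<bar>H\<bar> * (\<bar>\<beta> k\<bar> * B * 1)" for \<omega>
        unfolding v_def abs_mult using h_le[of \<omega>] u_le[of k \<omega>] B0
        by (intro mult_mono) (auto split: split_indicator)
      then have "integrable M (\<lambda>\<omega>. v \<omega> * w k \<omega>)"
        by (intro Bochner_Integration.integrable_bound[OF integrable_mult_right[OF w_int, of "\<bar>H\<bar> * (\<bar>\<beta> k\<bar> * B * 1)" k]])
          (use B0 in \<open>auto simp: abs_mult intro!: mult_right_mono\<close>)
      then have "(\<integral>\<omega>. v \<omega> * w k \<omega> \<partial>M) = (\<integral>\<omega>. v \<omega> * real_cond_exp M (F k) (w k) \<omega> \<partial>M)"
        using Fk.real_cond_exp_intg(2)[OF _ vF] by simp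
      also have "\<dots> = (\<integral>\<omega>. 0 \<partial>M)" using mds[of k] by (intro integral_cong_AE) auto
      finally show "(\<integral>\<omega>. h \<omega> * X k \<omega> \<partial>M) = 0" unfolding v_def X_def y_def by (simp add: mult_ac)
    qed (use subalg filtration X2 in auto)
    have "summable (\<lambda>k. \<integral>\<omega>. (X k \<omega>)\<^sup>2 \<partial>M)"
    proof (rule summable_comparison_test'[OF summable_mult[OF \<beta>, of "B\<^sup>2 * (1 + real K)"]])
      fix k
      have "(\<integral>\<omega>. (X k \<omega>)\<^sup>2 \<partial>M) \<le> (\<integral>\<omega>. (B\<^sup>2 * (\<beta> k)\<^sup>2) * (y K k \<omega>)\<^sup>2 \<partial>M)"
        by (rule integral_mono) (use X2 X2_le y2_int in auto)
      also have "\<dots> = (B\<^sup>2 * (\<beta> k)\<^sup>2) * (\<integral>\<omega>. (y K k \<omega>)\<^sup>2 \<partial>M)" by simp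
      also have "\<dots> \<le> (B\<^sup>2 * (\<beta> k)\<^sup>2) * (1 + real K)" using y2_le by (intro mult_left_mono) auto
      finally show "norm (\<integral>\<omega>. (X k \<omega>)\<^sup>2 \<partial>M) \<le> B\<^sup>2 * (1 + real K) * (\<beta> k)\<^sup>2" by (simp add: mult_ac)
    qed
    then show ?thesis using AE_summable unfolding X_def by blast
  qed
  \<comment> \<open>The terms are nonnegative and their expectations are summable, so the series has
    finite expectation and is finite almost surely.\<close>
  have AE2: "AE \<omega> in M. summable (\<lambda>k. (\<beta> k)\<^sup>2 * (y K k \<omega>)\<^sup>2)" for K
  proof -
    have "(\<integral>\<^sup>+\<omega>. (\<Sum>k. ennreal ((\<beta> k)\<^sup>2 * (y K k \<omega>)\<^sup>2)) \<partial>M) = (\<Sum>k. \<integral>\<^sup>+\<omega>. ennreal ((\<beta> k)\<^sup>2 * (y K k \<omega>)\<^sup>2) \<partial>M)"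
      by (rule nn_integral_suminf) measurable
    also have "\<dots> \<le> (\<Sum>k. ennreal ((\<beta> k)\<^sup>2 * (1 + real K)))"
    proof (rule suminf_le)
      fix k
      have "(\<integral>\<^sup>+\<omega>. ennreal ((\<beta> k)\<^sup>2 * (y K k \<omega>)\<^sup>2) \<partial>M) = ennreal ((\<beta> k)\<^sup>2) * (\<integral>\<^sup>+\<omega>. ennreal ((y K k \<omega>)\<^sup>2) \<partial>M)"
        by (simp add: ennreal_mult nn_integral_cmult)
      also have "\<dots> \<le> ennreal ((\<beta> k)\<^sup>2) * ennreal (1 + real K)" using y2 by (intro mult_left_mono) auto
      finally show "(\<integral>\<^sup>+\<omega>. ennreal ((\<beta> k)\<^sup>2 * (y K k \<omega>)\<^sup>2) \<partial>M) \<le> ennreal ((\<beta> k)\<^sup>2 * (1 + real K))"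
        by (simp add: ennreal_mult)
    qed auto
    also have "\<dots> = ennreal (\<Sum>k. (\<beta> k)\<^sup>2 * (1 + real K))"
      by (rule suminf_ennreal_eq) (use summable_sums[OF summable_mult2[OF \<beta>]] in auto)
    also have "\<dots> < \<infinity>" by simp
    finally have "AE \<omega> in M. (\<Sum>k. ennreal ((\<beta> k)\<^sup>2 * (y K k \<omega>)\<^sup>2)) \<noteq> \<infinity>"
      by (intro nn_integral_PInf_AE) auto
    then show ?thesis by eventually_elim (auto intro!: summable_suminf_not_top)
  qed
  \<comment> \<open>A finite supremum lies below some natural number \<open>K\<close>, and at that
    level the truncation never acts on the path. Only countably many levels occur, so their null
    sets can be united.\<close>
  have trunc: "\<exists>K. \<forall>k. y K k \<omega> = w k \<omega>"
    if sp: "\<omega> \<in> space M" and fin: "(\<Squnion>k. nn_cond_exp M (G k) (f k) \<omega>) < \<infinity>" for \<omega>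
  proof -
    obtain K :: nat where K: "(\<Squnion>k. nn_cond_exp M (G k) (f k) \<omega>) \<le> of_nat K"
      using ennreal_Ex_less_of_nat fin by (metis infinity_ennreal_def less_imp_le)
    have "\<omega> \<in> A K k" for k
      unfolding A_def using sp order_trans[OF SUP_upper K, of k] by simp
    then show ?thesis unfolding y_def by (intro exI[of _ K]) auto
  qed
  have "AE \<omega> in M. \<forall>K. summable (\<lambda>k. \<beta> k * u k \<omega> * y K k \<omega>)" using AE1 by (simp add: AE_all_countable)
  with bdd AE_space show "AE \<omega> in M. summable (\<lambda>k. \<beta> k * u k \<omega> * w k \<omega>)"
  proof eventually_elim
    case (elim \<omega>)
    obtain K where "\<And>k. y K k \<omega> = w k \<omega>" using trunc[OF elim(2,1)] by blast
    then show ?case using spec[OF elim(3), of K] by simp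
  qed
  have "AE \<omega> in M. \<forall>K. summable (\<lambda>k. (\<beta> k)\<^sup>2 * (y K k \<omega>)\<^sup>2)" using AE2 by (simp add: AE_all_countable)
  with bdd AE_space show "AE \<omega> in M. summable (\<lambda>k. (\<beta> k)\<^sup>2 * (w k \<omega>)\<^sup>2)"
  proof eventually_elim
    case (elim \<omega>)
    obtain K where "\<And>k. y K k \<omega> = w k \<omega>" using trunc[OF elim(2,1)] by blast
    then show ?case using spec[OF elim(3), of K] by simp
  qed
qed

text \<open>Finitely many noise series, one per edge and two per observation coordinate, converge
  outside a null set; every remaining path is an \<open>sc_path\<close>. The filtration
  \<open>F\<close> carries adaptedness and the martingale property, while the smaller
  \<open>G\<close> is the one for which the conditional moments are bounded.\<close>

theorem (in sc_network) AE_nsq_tendsto_0: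
  fixes M :: "'a measure" and F G :: "nat \<Rightarrow> 'a measure"
    and \<theta> :: "nat \<Rightarrow> real" and e w :: "nat \<Rightarrow> nat \<Rightarrow> nat \<Rightarrow> 'a \<Rightarrow> real"
    and d :: "nat \<Rightarrow> nat \<Rightarrow> 'a \<Rightarrow> real" and f :: "nat \<Rightarrow> nat \<Rightarrow> 'a \<Rightarrow> ennreal"
  assumes prob: "prob_space M"
    and subalg: "\<And>k. subalgebra M (F k)" and filtration: "\<And>k. subalgebra (F (Suc k)) (F k)"
    and subG: "\<And>k. subalgebra (F k) (G k)"
    and e0: "\<And>i l. i \<in> {1..N} \<Longrightarrow> l < n \<Longrightarrow> e 0 i l \<in> borel_measurable (F 0)"
    and step: "\<And>i l k \<omega>. i \<in> {1..N} \<Longrightarrow> l < n \<Longrightarrow> e (Suc k) i l \<omega> = e k i l \<omega>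
      + (if l = k mod n then \<Sum>j\<in>nbrs N a i. \<alpha> i j (Suc k) * a i j
          * (recv \<nu> b j i (Suc k) (\<theta> (k mod n) + e k j (k mod n) \<omega>) (d k j \<omega>)
            - Gfun \<nu> b i j (Suc k) (\<theta> (k mod n) + e k i (k mod n) \<omega>)) else 0)
      + \<beta> i (Suc k) * (\<Sum>r<m i. h i (Suc k) r l * (w k i r \<omega> - obs i k (\<lambda>l. e k i l \<omega>) r))"
    and d: "\<And>k j. j \<in> {1..N} \<Longrightarrow> d k j \<in> borel_measurable (F (Suc k))"
    and lap: "\<And>k j. j \<in> {1..N} \<Longrightarrow> distributed M lborel (d k j) (\<lambda>t. ennreal (exp (- \<bar>t\<bar>) / 2))"
    and ind: "\<And>k j. j \<in> {1..N} \<Longrightarrow> prob_space.indep_set M (sets (F k)) (sets (sigma_fun M {d k j}))"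
    and w: "\<And>k i r. i \<in> {1..N} \<Longrightarrow> r < m i \<Longrightarrow> w k i r \<in> borel_measurable (F (Suc k))"
    and w_int: "\<And>k i r. i \<in> {1..N} \<Longrightarrow> r < m i \<Longrightarrow> integrable M (w k i r)"
    and mds: "\<And>k i r. i \<in> {1..N} \<Longrightarrow> r < m i \<Longrightarrow> AE \<omega> in M. real_cond_exp M (F k) (w k i r) \<omega> = 0"
    and f: "\<And>k i. i \<in> {1..N} \<Longrightarrow> f k i \<in> borel_measurable M"
    and f_ge: "\<And>k i r \<omega>. i \<in> {1..N} \<Longrightarrow> r < m i \<Longrightarrow> ennreal ((w k i r \<omega>)\<^sup>2) \<le> 1 + f k i \<omega>"
    and bdd: "\<And>i. i \<in> {1..N} \<Longrightarrow> AE \<omega> in M. (\<Squnion>k. nn_cond_exp M (G k) (f k i) \<omega>) < \<infinity>"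
  shows "AE \<omega> in M. (\<lambda>k. nsq (\<lambda>i l. e k i l \<omega>)) \<longlonglongrightarrow> 0"
proof -
  interpret prob_space M by (rule prob)
  let ?q = "\<lambda>k. k mod n"
  have q: "?q k < n" for k using n_pos by simp
  have V_edge: "i \<in> {1..N}" "j \<in> {1..N}" if "(i, j) \<in> edges N a" for i j
    using that by (auto simp: edges_def)
  have adapted: "e k i l \<in> borel_measurable (F k)" if "i \<in> {1..N}" "l < n" for k i l
    using that
  proof (induction k arbitrary: i l)
    case (Suc k)
    have e_meas: "e k i l \<in> borel_measurable (F (Suc k))" if "i \<in> {1..N}" "l < n" for i l
      by (rule measurable_from_subalg[OF filtration Suc.IH[OF that]])
    have [measurable]: "e k i l \<in> borel_measurable (F (Suc k))" "e k i (?q k) \<in> borel_measurable (F (Suc k))"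
      using e_meas Suc.prems q by auto
    have recv: "(\<lambda>\<omega>. recv \<nu> b j i (Suc k) (\<theta> (?q k) + e k j (?q k) \<omega>) (d k j \<omega>)) \<in> borel_measurable (F (Suc k))"
      if "j \<in> nbrs N a i" for j
    proof -
      have j: "j \<in> {1..N}" using that by (auto simp: nbrs_def edges_def)
      have [measurable]: "e k j (?q k) \<in> borel_measurable (F (Suc k))" "d k j \<in> borel_measurable (F (Suc k))"
        using e_meas[OF j q] d[OF j] .
      show ?thesis by measurable
    qed
    have obs: "(\<lambda>\<omega>. obs i k (\<lambda>l. e k i l \<omega>) r) \<in> borel_measurable (F (Suc k))" for r
      unfolding obs_def using e_meas Suc.prems by (intro borel_measurable_sum borel_measurable_times) auto
    have "e (Suc k) i l = (\<lambda>\<omega>. e k i l \<omega>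
      + (if l = ?q k then \<Sum>j\<in>nbrs N a i. \<alpha> i j (Suc k) * a i j
          * (recv \<nu> b j i (Suc k) (\<theta> (?q k) + e k j (?q k) \<omega>) (d k j \<omega>)
            - Gfun \<nu> b i j (Suc k) (\<theta> (?q k) + e k i (?q k) \<omega>)) else 0)
      + \<beta> i (Suc k) * (\<Sum>r<m i. h i (Suc k) r l * (w k i r \<omega> - obs i k (\<lambda>l. e k i l \<omega>) r)))"
      using step[OF Suc.prems] by blast
    also have "\<dots> \<in> borel_measurable (F (Suc k))"
      using recv obs w Suc.prems
      by (intro borel_measurable_add borel_measurable_times borel_measurable_sum borel_measurable_diff
          borel_measurable_const measurable_If) auto
    finally show ?case .
  qed (use e0 in auto)
  have nsq_meas: "(\<lambda>\<omega>. nsq (\<lambda>i l. e k i l \<omega>)) \<in> borel_measurable (F k)" for k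
    unfolding nsq_def using adapted by (intro borel_measurable_sum borel_measurable_power) auto
  have dither: "AE \<omega> in M. \<forall>(i, j)\<in>edges N a. summable (\<lambda>k. \<alpha> i j (Suc k)
      * (e k i (?q k) \<omega> / (1 + nsq (\<lambda>i l. e k i l \<omega>)))
      * (recv \<nu> b j i (Suc k) (\<theta> (?q k) + e k j (?q k) \<omega>) (d k j \<omega>)
        - Gfun \<nu> b i j (Suc k) (\<theta> (?q k) + e k j (?q k) \<omega>)))"
  proof (intro AE_finite_allI finite_edges, clarify)
    fix i j assume ij: "(i, j) \<in> edges N a"
    have i: "i \<in> {1..N}" and j: "j \<in> {1..N}" using V_edge[OF ij] .
    \<comment> \<open>A message from \<open>j\<close> to \<open>i\<close> is formed with the
      coefficients of the pair \<open>(j, i)\<close>, so the reversed edge and the symmetry of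
      \<open>Gfun\<close> are called for.\<close>
    have ji: "(j, i) \<in> edges N a" using ij a_sym[of i j] by (auto simp: edges_def)
    show "AE \<omega> in M. summable (\<lambda>k. \<alpha> i j (Suc k)
      * (e k i (?q k) \<omega> / (1 + nsq (\<lambda>i l. e k i l \<omega>)))
      * (recv \<nu> b j i (Suc k) (\<theta> (?q k) + e k j (?q k) \<omega>) (d k j \<omega>)
        - Gfun \<nu> b i j (Suc k) (\<theta> (?q k) + e k j (?q k) \<omega>)))"
      unfolding Gfun_sym[of i j]
    proof (rule dither_noise_AE_summable[where F=F and B=1])
      fix k
      show "(\<lambda>\<omega>. \<theta> (?q k) + e k j (?q k) \<omega>) \<in> borel_measurable (F k)"
        using adapted[OF j q] by simp
      show "(\<lambda>\<omega>. e k i (?q k) \<omega> / (1 + nsq (\<lambda>i l. e k i l \<omega>))) \<in> borel_measurable (F k)"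
        using adapted[OF i q] nsq_meas by (intro borel_measurable_divide borel_measurable_add) auto
      fix \<omega>
      let ?v = "nsq (\<lambda>i l. e k i l \<omega>)"
      \<comment> \<open>This is the gain from the logarithm: after division by
        \<open>1 + nsq\<close> the weight is at most \<open>1\<close> on every path, however large
        the error.\<close>
      have "\<bar>e k i (?q k) \<omega>\<bar> \<le> 1 + ?v"
        using abs_le_one_plus_square[of "e k i (?q k) \<omega>"] square_le_nsq[OF i q, of "\<lambda>i l. e k i l \<omega>" k] by simp
      then show "\<bar>e k i (?q k) \<omega> / (1 + ?v)\<bar> \<le> 1"
        using nsq_nonneg[of "\<lambda>i l. e k i l \<omega>"] by (simp add: abs_divide)
    qed (use subalg filtration d[OF j] lap[OF j] ind[OF j] b_pos[OF ji] \<nu>_nonneg[OF ji] \<alpha>_square_summable[OF ij] in auto)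
  qed
  have obs_le: "\<bar>obs i k (\<lambda>l. e k i l \<omega>) r / (1 + nsq (\<lambda>i l. e k i l \<omega>))\<bar> \<le> 1 + real n * Hb\<^sup>2"
    if "i \<in> {1..N}" "r < m i" for i k r \<omega>
  proof -
    let ?v = "nsq (\<lambda>i l. e k i l \<omega>)"
    have v: "0 \<le> ?v" by (rule nsq_nonneg)
    have "(obs i k (\<lambda>l. e k i l \<omega>) r)\<^sup>2 \<le> real n * Hb\<^sup>2 * (\<Sum>l<n. (e k i l \<omega>)\<^sup>2)"
      by (rule obs_square_le[OF that])
    also have "\<dots> \<le> real n * Hb\<^sup>2 * ?v"
      using sum_square_le_nsq[OF that(1), of "\<lambda>i l. e k i l \<omega>"] by (intro mult_left_mono) auto
    finally have "\<bar>obs i k (\<lambda>l. e k i l \<omega>) r\<bar> \<le> 1 + real n * Hb\<^sup>2 * ?v"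
      using abs_le_one_plus_square[of "obs i k (\<lambda>l. e k i l \<omega>) r"] by linarith
    also have "\<dots> \<le> (1 + real n * Hb\<^sup>2) * (1 + ?v)" using v by (simp add: algebra_simps)
    finally show ?thesis using v by (simp add: abs_divide divide_le_eq)
  qed
  have obs_meas: "(\<lambda>\<omega>. obs i k (\<lambda>l. e k i l \<omega>) r / (1 + nsq (\<lambda>i l. e k i l \<omega>))) \<in> borel_measurable (F k)"
    if "i \<in> {1..N}" for i k r
    unfolding obs_def using that adapted nsq_meas
    by (intro borel_measurable_divide borel_measurable_add borel_measurable_sum borel_measurable_times) auto
  have obs1: "AE \<omega> in M. \<forall>i\<in>{1..N}. \<forall>r\<in>{..<m i}.
      summable (\<lambda>k. \<beta> i (Suc k) * (obs i k (\<lambda>l. e k i l \<omega>) r / (1 + nsq (\<lambda>i l. e k i l \<omega>))) * w k i r \<omega>)"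
    and obs2: "AE \<omega> in M. \<forall>i\<in>{1..N}. \<forall>r\<in>{..<m i}. summable (\<lambda>k. (\<beta> i (Suc k))\<^sup>2 * (w k i r \<omega>)\<^sup>2)"
  proof -
    have *: "AE \<omega> in M. summable (\<lambda>k. \<beta> i (Suc k) * (obs i k (\<lambda>l. e k i l \<omega>) r / (1 + nsq (\<lambda>i l. e k i l \<omega>))) * w k i r \<omega>)"
      "AE \<omega> in M. summable (\<lambda>k. (\<beta> i (Suc k))\<^sup>2 * (w k i r \<omega>)\<^sup>2)"
      if i: "i \<in> {1..N}" and r: "r < m i" for i r
      by (rule obs_noise_AE_summable[where F=F and G=G and f="\<lambda>k. f k i" and B="1 + real n * Hb\<^sup>2"
            and u="\<lambda>k \<omega>. obs i k (\<lambda>l. e k i l \<omega>) r / (1 + nsq (\<lambda>i l. e k i l \<omega>))"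
            and w="\<lambda>k. w k i r" and \<beta>="\<lambda>k. \<beta> i (Suc k)"];
          use subalg filtration subG in \<open>simp add: w[OF i r] w_int[OF i r] mds[OF i r] f[OF i] f_ge[OF i r]
            bdd[OF i, simplified] obs_meas[OF i] obs_le[OF i r, simplified] \<beta>_square_summable[OF i]\<close>)+
    show "AE \<omega> in M. \<forall>i\<in>{1..N}. \<forall>r\<in>{..<m i}.
      summable (\<lambda>k. \<beta> i (Suc k) * (obs i k (\<lambda>l. e k i l \<omega>) r / (1 + nsq (\<lambda>i l. e k i l \<omega>))) * w k i r \<omega>)"
      "AE \<omega> in M. \<forall>i\<in>{1..N}. \<forall>r\<in>{..<m i}. summable (\<lambda>k. (\<beta> i (Suc k))\<^sup>2 * (w k i r \<omega>)\<^sup>2)"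
      using * by (auto intro!: AE_finite_allI)
  qed
  from dither obs1 obs2 show ?thesis
  proof eventually_elim
    case (elim \<omega>)
    interpret sc_path n N m a \<nu> b \<alpha> \<beta> h Hb \<delta> c p z \<theta> "\<lambda>k i l. e k i l \<omega>"
      "\<lambda>k i j. recv \<nu> b j i (Suc k) (\<theta> (?q k) + e k j (?q k) \<omega>) (d k j \<omega>)" "\<lambda>k i r. w k i r \<omega>"
      by unfold_locales (use step elim abs_recv_le in auto)
    show ?case by (rule nsq_tendsto_0)
  qed
qed

section \<open>Reduction to coordinates\<close>

unbundle no vec_syntax

lemma vnorm_eq: "vnorm v = sqrt (\<Sum>l<dim_vec v. (v $ l)\<^sup>2)"
  by (simp add: vnorm_def scalar_prod_def power2_eq_square atLeast0LessThan)

lemma abs_vec_index_le_vnorm: "l < dim_vec v \<Longrightarrow> \<bar>v $ l\<bar> \<le> vnorm v"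
  unfolding vnorm_eq
  by (rule real_le_rsqrt) (use member_le_sum[of l "{..<dim_vec v}" "\<lambda>l. (v $ l)\<^sup>2"] in auto)

text \<open>For norm at most \<open>1\<close> the constant suffices; beyond that, the square of the
  norm is at most its power \<open>\<rho>\<close>. This brings the moment assumption down to second
  moments of single coordinates.\<close>

lemma vec_index_square_le_moment:
  assumes "l < dim_vec v" "2 \<le> \<rho>"
  shows "(v $ l)\<^sup>2 \<le> 1 + vnorm v powr \<rho>"
proof (cases "vnorm v \<le> 1")
  case True
  then have "(v $ l)\<^sup>2 \<le> 1\<^sup>2" using abs_vec_index_le_vnorm[OF assms(1)] by (subst abs_le_square_iff[symmetric]) auto
  then show ?thesis by (smt (verit) one_power2 powr_ge_zero)
next
  case False
  have "(v $ l)\<^sup>2 \<le> (vnorm v)\<^sup>2"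
    using abs_vec_index_le_vnorm[OF assms(1)] False by (subst abs_le_square_iff[symmetric]) auto
  also have "\<dots> = vnorm v powr 2" using False by simp
  also have "\<dots> \<le> vnorm v powr \<rho>" using False assms by (intro powr_mono) auto
  finally show ?thesis by simp
qed

text \<open>An entry is a coordinate of the image of a unit vector, so the operator norm bound
  controls it.\<close>

lemma mat_entry_le:
  assumes A: "A \<in> carrier_mat m n" and bound: "\<And>x. x \<in> carrier_vec n \<Longrightarrow> vnorm (A *\<^sub>v x) \<le> C * vnorm x"
    and r: "r < m" and l: "l < n"
  shows "\<bar>A $$ (r, l)\<bar> \<le> C"
proof -
  have "A $$ (r, l) = (A *\<^sub>v unit_vec n l) $ r"
    using A r l by (simp add: scalar_prod_right_unit)
  also have "\<bar>\<dots>\<bar> \<le> vnorm (A *\<^sub>v unit_vec n l)" using A r by (intro abs_vec_index_le_vnorm) auto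
  also have "\<dots> \<le> C * vnorm (unit_vec n l)" by (rule bound) simp
  also have "vnorm (unit_vec n l) = 1" using l by (simp add: vnorm_def scalar_prod_left_unit)
  finally show ?thesis by simp
qed

lemma mult_mat_vec_index_sum:
  assumes "A \<in> carrier_mat m n" "x \<in> carrier_vec n" "r < m"
  shows "(A *\<^sub>v x) $ r = (\<Sum>l<n. A $$ (r, l) * x $ l)"
  using assms by (simp add: scalar_prod_def atLeast0LessThan)

lemma gram_quadratic_form:
  fixes A :: "real mat"
  assumes A: "A \<in> carrier_mat m n" and x: "x \<in> carrier_vec n"
  shows "x \<bullet> ((transpose_mat A * A) *\<^sub>v x) = (\<Sum>r<m. (\<Sum>l<n. A $$ (r, l) * x $ l)\<^sup>2)"
proof -
  have Ax: "A *\<^sub>v x \<in> carrier_vec m" using A x by simp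
  have t: "(transpose_mat A *\<^sub>v (A *\<^sub>v x)) $ l = (\<Sum>r<m. A $$ (r, l) * (A *\<^sub>v x) $ r)" if "l < n" for l
    using A Ax that by (subst mult_mat_vec_index_sum[of _ n m]) auto
  have "x \<bullet> ((transpose_mat A * A) *\<^sub>v x) = x \<bullet> (transpose_mat A *\<^sub>v (A *\<^sub>v x))"
    using A x by (subst assoc_mult_mat_vec[of _ n m _ n]) auto
  also have "\<dots> = (\<Sum>l<n. x $ l * (\<Sum>r<m. A $$ (r, l) * (A *\<^sub>v x) $ r))"
    using A unfolding scalar_prod_def[of x]
    by (auto simp: atLeast0LessThan t simp del: index_mult_mat_vec intro!: sum.cong)
  also have "\<dots> = (\<Sum>r<m. (A *\<^sub>v x) $ r * (\<Sum>l<n. A $$ (r, l) * x $ l))"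
    unfolding sum_distrib_left by (subst sum.swap) (simp add: mult_ac)
  also have "\<dots> = (\<Sum>r<m. (\<Sum>l<n. A $$ (r, l) * x $ l)\<^sup>2)"
    using mult_mat_vec_index_sum[OF A x] by (simp add: power2_eq_square)
  finally show ?thesis .
qed

lemma sc_est_carrier:
  assumes "\<And>i. i \<in> {1..N} \<Longrightarrow> \<theta>0 i \<in> carrier_vec n"
    and "\<And>i k. i \<in> {1..N} \<Longrightarrow> 1 \<le> k \<Longrightarrow> H i k \<in> carrier_mat (m i) n"
    and "i \<in> {1..N}"
  shows "sc_est n N a \<nu> b \<alpha> \<beta> H \<theta>0 d y k i \<in> carrier_vec n"
proof (cases k)
  case (Suc k')
  have "H i (Suc k') \<in> carrier_mat (m i) n" using assms by auto
  then have "dim_col (H i (Suc k')) = n" by simp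
  then show ?thesis
    unfolding Suc sc_est.simps Let_def
    by (intro carrier_vecI) (simp only: index_add_vec(2) index_smult_vec(2) dim_mult_mat_vec index_transpose_mat(2))
qed (use assms in auto)

text \<open>Inserting the observation model into the innovation leaves the noise minus the
  observation matrix applied to the error. The regressor of time \<open>Suc k\<close> is the unit
  vector with index \<open>k mod n\<close>, so the consensus term moves that coordinate
  only.\<close>

lemma sc_est_Suc_index:
  fixes a \<nu> b :: "nat \<Rightarrow> nat \<Rightarrow> real" and \<alpha> :: "nat \<Rightarrow> nat \<Rightarrow> nat \<Rightarrow> real" and \<beta> d :: "nat \<Rightarrow> nat \<Rightarrow> real"
    and w :: "nat \<Rightarrow> nat \<Rightarrow> nat \<Rightarrow> real"
  assumes n: "0 < n" and \<theta>0: "\<And>i. i \<in> {1..N} \<Longrightarrow> \<theta>0 i \<in> carrier_vec n"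
    and H: "\<And>i k. i \<in> {1..N} \<Longrightarrow> 1 \<le> k \<Longrightarrow> H i k \<in> carrier_mat (m i) n"
    and \<theta>: "\<theta> \<in> carrier_vec n" and i: "i \<in> {1..N}" and l: "l < n"
  defines "est \<equiv> sc_est n N a \<nu> b \<alpha> \<beta> H \<theta>0 d (\<lambda>j t. H j t *\<^sub>v \<theta> + vec (m j) (w j t))"
  shows "est (Suc k) i $ l = est k i $ l
    + (if l = k mod n then \<Sum>j\<in>nbrs N a i. \<alpha> i j (Suc k) * a i j
        * (recv \<nu> b j i (Suc k) (est k j $ (k mod n)) (d j (Suc k)) - Gfun \<nu> b i j (Suc k) (est k i $ (k mod n))) else 0)
    + \<beta> i (Suc k) * (\<Sum>r<m i. H i (Suc k) $$ (r, l)
        * (w i (Suc k) r - (\<Sum>u<n. H i (Suc k) $$ (r, u) * (est k i $ u - \<theta> $ u))))"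
proof -
  let ?H = "H i (Suc k)" and ?q = "k mod n"
  have q: "?q < n" using n by simp
  have est: "est k j \<in> carrier_vec n" if "j \<in> {1..N}" for j
    unfolding est_def using sc_est_carrier[OF \<theta>0 H that] .
  have HH: "?H \<in> carrier_mat (m i) n" using H i by auto
  have phi: "phi n (Suc k) \<bullet> est k j = est k j $ ?q" if "j \<in> {1..N}" for j
    unfolding phi_def using est[OF that] q by (simp add: scalar_prod_left_unit)
  have nb: "(\<Sum>j\<in>nbrs N a i. \<alpha> i j (Suc k) * a i j * (recv \<nu> b j i (Suc k) (phi n (Suc k) \<bullet> est k j) (d j (Suc k))
        - Gfun \<nu> b i j (Suc k) (phi n (Suc k) \<bullet> est k i)))
      = (\<Sum>j\<in>nbrs N a i. \<alpha> i j (Suc k) * a i j * (recv \<nu> b j i (Suc k) (est k j $ ?q) (d j (Suc k))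
        - Gfun \<nu> b i j (Suc k) (est k i $ ?q)))"
    by (rule sum.cong[OF refl]) (subst (1 2) phi, use i in \<open>auto simp: nbrs_def edges_def\<close>)
  define v where "v = (?H *\<^sub>v \<theta> + vec (m i) (w i (Suc k))) - ?H *\<^sub>v est k i"
  have v: "v \<in> carrier_vec (m i)" unfolding v_def using HH by (auto intro!: carrier_vecI)
  have v_index: "v $ r = w i (Suc k) r - (\<Sum>u<n. ?H $$ (r, u) * (est k i $ u - \<theta> $ u))" if "r < m i" for r
    unfolding v_def using that HH est[OF i] \<theta>
    by (simp add: mult_mat_vec_index_sum[OF HH] right_diff_distrib sum_subtractf del: index_mult_mat_vec)
  have tv: "(transpose_mat ?H *\<^sub>v v) $ l = (\<Sum>r<m i. ?H $$ (r, l) * v $ r)"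
    using HH v l by (subst mult_mat_vec_index_sum[of _ n "m i"]) auto
  have "est (Suc k) i = est k i
      + (\<Sum>j\<in>nbrs N a i. \<alpha> i j (Suc k) * a i j * (recv \<nu> b j i (Suc k) (phi n (Suc k) \<bullet> est k j) (d j (Suc k))
        - Gfun \<nu> b i j (Suc k) (phi n (Suc k) \<bullet> est k i))) \<cdot>\<^sub>v phi n (Suc k)
      + \<beta> i (Suc k) \<cdot>\<^sub>v (transpose_mat ?H *\<^sub>v v)"
    unfolding est_def v_def by (simp only: sc_est.simps Let_def)
  then have "est (Suc k) i = est k i
      + (\<Sum>j\<in>nbrs N a i. \<alpha> i j (Suc k) * a i j * (recv \<nu> b j i (Suc k) (est k j $ ?q) (d j (Suc k))
        - Gfun \<nu> b i j (Suc k) (est k i $ ?q))) \<cdot>\<^sub>v phi n (Suc k)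
      + \<beta> i (Suc k) \<cdot>\<^sub>v (transpose_mat ?H *\<^sub>v v)"
    unfolding nb .
  then have "est (Suc k) i $ l = est k i $ l
      + (\<Sum>j\<in>nbrs N a i. \<alpha> i j (Suc k) * a i j * (recv \<nu> b j i (Suc k) (est k j $ ?q) (d j (Suc k))
        - Gfun \<nu> b i j (Suc k) (est k i $ ?q))) * phi n (Suc k) $ l
      + \<beta> i (Suc k) * (transpose_mat ?H *\<^sub>v v) $ l"
    using HH l est[OF i] by (simp add: phi_def del: index_mult_mat_vec)
  also have "phi n (Suc k) $ l = (if l = ?q then 1 else 0)" using l q by (simp add: phi_def)
  finally show ?thesis unfolding tv using v_index by simp
qed

text \<open>Disjoint blocks of an independent family generate independent sigma-algebras. One block
  holds the whole observation noise, encoded by \<open>None\<close>, together with the dithers up to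
  time \<open>k\<close>; the other holds one dither of time \<open>Suc k\<close>.\<close>

lemma (in prob_space) indep_past_dither:
  fixes d :: "'i \<Rightarrow> nat \<Rightarrow> 'a \<Rightarrow> real"
  assumes ind: "indep_sets (\<lambda>q. case q of Some (i, k) \<Rightarrow> sets (sigma_fun M {d i k}) | None \<Rightarrow> sets (sigma_fun M W))
        ({Some (i, k) | i k. i \<in> V \<and> 1 \<le> k} \<union> {None})"
    and j: "j \<in> V" and S: "S \<subseteq> W \<union> {d i t | i t. i \<in> V \<and> 1 \<le> t \<and> t \<le> k}"
  shows "indep_set (sets (sigma_fun M S)) (sets (sigma_fun M {d j (Suc k)}))"
proof -
  let ?E = "\<lambda>q. case q of Some (i, k) \<Rightarrow> sets (sigma_fun M {d i k}) | None \<Rightarrow> sets (sigma_fun M W)"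
  define I where "I = case_bool ({Some (i, t) | i t. i \<in> V \<and> 1 \<le> t \<and> t \<le> k} \<union> {None}) {Some (j, Suc k)}"
  have "indep_sets (\<lambda>q. sigma_sets (space M) (\<Union>i\<in>I q. ?E i)) UNIV"
  proof (rule indep_sets_collect_sigma)
    show "indep_sets ?E (\<Union>q\<in>UNIV. I q)"
      by (rule indep_sets_mono_index[OF _ ind]) (use j in \<open>auto simp: I_def split: bool.splits\<close>)
    show "Int_stable (?E q)" for q by (auto simp: Int_stable_def split: option.split)
    show "disjoint_family_on I UNIV"
      by (auto simp: disjoint_family_on_def I_def split: bool.splits)
  qed
  then show ?thesis
    unfolding indep_set_def
  proof (rule indep_sets_mono_sets)
    have past: "sets (sigma_fun M S) \<subseteq> sigma_sets (space M) (\<Union>i\<in>I True. ?E i)"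
      unfolding sets_sigma_fun[of M S]
    proof (rule sigma_sets_mono, safe)
      fix f :: "'a \<Rightarrow> real" and A :: "real set" assume "f \<in> S" and A: "A \<in> sets borel"
      then consider "f \<in> W" | i t where "f = d i t" "i \<in> V" "1 \<le> t" "t \<le> k" using S by auto
      then have "\<exists>q\<in>I True. f -` A \<inter> space M \<in> ?E q"
      proof cases
        case 1
        then have "f -` A \<inter> space M \<in> ?E None"
          using measurable_sets[OF measurable_sigma_fun[of f W M] A] by simp
        then show ?thesis by (intro bexI[of _ None]) (auto simp: I_def)
      next
        case 2
        then have "f -` A \<inter> space M \<in> ?E (Some (i, t))"
          using measurable_sets[OF measurable_sigma_fun[of f "{d i t}" M] A] by simp
        then show ?thesis using 2 by (intro bexI[of _ "Some (i, t)"]) (auto simp: I_def)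
      qed
      then show "f -` A \<inter> space M \<in> sigma_sets (space M) (\<Union>i\<in>I True. ?E i)" by auto
    qed
    show "(case q of True \<Rightarrow> sets (sigma_fun M S) | False \<Rightarrow> sets (sigma_fun M {d j (Suc k)}))
        \<subseteq> sigma_sets (space M) (\<Union>i\<in>I q. ?E i)" for q
      using past by (cases q) (auto simp: I_def)
  qed
qed

theorem theorem4p1:
  fixes M :: "'a measure"
    and n N :: nat
    and m :: "nat \<Rightarrow> nat"
    and \<theta> :: "real vec"
    and H :: "nat \<Rightarrow> nat \<Rightarrow> real mat"
    and w :: "nat \<Rightarrow> nat \<Rightarrow> nat \<Rightarrow> 'a \<Rightarrow> real"
    and d :: "nat \<Rightarrow> nat \<Rightarrow> 'a \<Rightarrow> real"
    and a \<nu> b :: "nat \<Rightarrow> nat \<Rightarrow> real"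
    and \<alpha> :: "nat \<Rightarrow> nat \<Rightarrow> nat \<Rightarrow> real"
    and \<beta> :: "nat \<Rightarrow> nat \<Rightarrow> real"
    and \<theta>0 :: "nat \<Rightarrow> real vec"
    and Hbar \<delta> :: real and p :: nat
  defines "V \<equiv> {1..N}"
    and "E \<equiv> edges N a"
    and "wvec \<equiv> (\<lambda>i k \<omega>. vec (m i) (\<lambda>r. w i k r \<omega>))"
    and "Wall \<equiv> {w i t r | i t r. i \<in> {1..N} \<and> 1 \<le> t \<and> r < m i}"
    and "Fw \<equiv> (\<lambda>k. sigma_fun M {w i t r | i t r. i \<in> {1..N} \<and> 1 \<le> t \<and> t \<le> k \<and> r < m i})"
    and "F \<equiv> (\<lambda>k. sigma_fun M ({w i t r | i t r. i \<in> {1..N} \<and> 1 \<le> t \<and> t \<le> k \<and> r < m i}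
                              \<union> {d i t | i t. i \<in> {1..N} \<and> 1 \<le> t \<and> t \<le> k}))"
    and "z \<equiv> (\<lambda>k. Min ({\<alpha> i j k / real k powr \<nu> i j | i j. (i, j) \<in> edges N a}
                       \<union> {\<beta> i k | i. i \<in> {1..N}}))"
  assumes prob: "prob_space M"
    \<comment> \<open>network\<close>
    and a_sym: "\<And>i j. a i j = a j i" and a_nonneg: "\<And>i j. 0 \<le> a i j"
    \<comment> \<open>(A3)\<close>
    and A3: "graph_connected N a"
    \<comment> \<open>dimensions\<close>
    and theta_dim: "\<theta> \<in> carrier_vec n"
    and theta0_dim: "\<And>i. i \<in> V \<Longrightarrow> \<theta>0 i \<in> carrier_vec n"
    and H_dim: "\<And>i k. i \<in> V \<Longrightarrow> 1 \<le> k \<Longrightarrow> H i k \<in> carrier_mat (m i) n"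
    \<comment> \<open>(A1)\<close>
    and A1_bound: "Hbar > 0"
      "\<And>i k x. i \<in> V \<Longrightarrow> 1 \<le> k \<Longrightarrow> x \<in> carrier_vec n \<Longrightarrow> vnorm (H i k *\<^sub>v x) \<le> Hbar * vnorm x"
    and A1_pe: "p > 0" "\<delta> > 0"
      "\<And>k x. 1 \<le> k \<Longrightarrow> x \<in> carrier_vec n \<Longrightarrow>
         (1 / real p) * (\<Sum>t\<in>{k..k+p-1}. \<Sum>i\<in>V. x \<bullet> ((transpose_mat (H i t) * H i t) *\<^sub>v x))
           \<ge> \<delta> * (x \<bullet> x)"
    \<comment> \<open>(A2)\<close>
    and w_meas: "\<And>i k r. i \<in> V \<Longrightarrow> 1 \<le> k \<Longrightarrow> r < m i \<Longrightarrow> w i k r \<in> borel_measurable M"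
    and w_int: "\<And>i k r. i \<in> V \<Longrightarrow> 1 \<le> k \<Longrightarrow> r < m i \<Longrightarrow> integrable M (w i k r)"
    and w_mds: "\<And>i k r. i \<in> V \<Longrightarrow> 1 \<le> k \<Longrightarrow> r < m i \<Longrightarrow>
                  AE \<omega> in M. real_cond_exp M (F (k - 1)) (w i k r) \<omega> = 0"
    and w_moment: "\<exists>\<rho>::real. \<rho> > 2 \<and>
        (AE \<omega> in M. (\<Squnion>i\<in>V. \<Squnion>k\<in>{1..}.
            nn_cond_exp M (Fw (k - 1)) (\<lambda>\<omega>'. ennreal (vnorm (wvec i k \<omega>') powr \<rho>)) \<omega>) < \<infinity>)"
    \<comment> \<open>(A4)\<close>
    and d_meas: "\<And>i k. i \<in> V \<Longrightarrow> 1 \<le> k \<Longrightarrow> d i k \<in> borel_measurable M"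
    and d_lap: "\<And>i k. i \<in> V \<Longrightarrow> 1 \<le> k \<Longrightarrow>
                  distributed M lborel (d i k) (\<lambda>x. ennreal (exp (- \<bar>x\<bar>) / 2))"
    and d_indep: "prob_space.indep_sets M
        (\<lambda>q. case q of Some (i, k) \<Rightarrow> sets (sigma_fun M {d i k}) | None \<Rightarrow> sets (sigma_fun M Wall))
        ({Some (i, k) | i k. i \<in> V \<and> 1 \<le> k} \<union> {None})"
    \<comment> \<open>algorithm parameters\<close>
    and \<nu>_sym: "\<And>i j. \<nu> i j = \<nu> j i" and \<nu>_nonneg: "\<And>i j. (i, j) \<in> E \<Longrightarrow> 0 \<le> \<nu> i j"
    and b_sym: "\<And>i j. b i j = b j i" and b_pos: "\<And>i j. (i, j) \<in> E \<Longrightarrow> 0 < b i j"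
    and \<alpha>_sym: "\<And>i j k. \<alpha> i j k = \<alpha> j i k"
    and \<alpha>_pos: "\<And>i j k. (i, j) \<in> E \<Longrightarrow> 1 \<le> k \<Longrightarrow> 0 < \<alpha> i j k"
    and \<beta>_pos: "\<And>i k. i \<in> V \<Longrightarrow> 1 \<le> k \<Longrightarrow> 0 < \<beta> i k"
    \<comment> \<open>step-size conditions (i)-(iii)\<close>
    and step_i: "\<And>i j. (i, j) \<in> E \<Longrightarrow>
        summable (\<lambda>k. (\<alpha> i j k)\<^sup>2) \<and> (\<exists>c. \<forall>k\<ge>1. \<alpha> i j (k + 1) / \<alpha> i j k \<le> c)"
    and step_ii: "\<And>i. i \<in> V \<Longrightarrow>
        summable (\<lambda>k. (\<beta> i k)\<^sup>2) \<and> (\<exists>c. \<forall>k\<ge>1. \<beta> i (k + 1) / \<beta> i k \<le> c)"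
    and step_iii: "filterlim (\<lambda>K. \<Sum>k=1..K. z k) at_top sequentially"
  shows "\<forall>i\<in>V. AE \<omega> in M.
           (\<lambda>k. vnorm (sc_est n N a \<nu> b \<alpha> \<beta> H \<theta>0 (\<lambda>j t. d j t \<omega>)
                          (\<lambda>j t. H j t *\<^sub>v \<theta> + wvec j t \<omega>) k i - \<theta>)) \<longlonglongrightarrow> 0"
proof (cases "n = 0 \<or> N = 0")
  \<comment> \<open>Without sensors there is nothing to show, and in dimension \<open>0\<close>
    every norm is \<open>0\<close>. From here on the index \<open>k mod n\<close> is a valid
    coordinate, and the minimum in \<open>z\<close> is over a nonempty set.\<close>
  case True
  then have "V = {} \<or> (\<forall>v. vnorm (v - \<theta>) = 0)"
    using theta_dim by (auto simp: V_def vnorm_eq)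
  then show ?thesis by auto
next
  case False
  interpret prob_space M by (rule prob)
  have n: "0 < n" and N: "0 < N" using False by auto
  have iV: "i \<in> V \<longleftrightarrow> i \<in> {1..N}" for i by (simp add: V_def)
  let ?X = "\<lambda>k. {\<alpha> i j k / real k powr \<nu> i j | i j. (i, j) \<in> edges N a} \<union> {\<beta> i k | i. i \<in> {1..N}}"
  have finX: "finite (?X k)" for k
  proof -
    have "?X k = (\<lambda>(i, j). \<alpha> i j k / real k powr \<nu> i j) ` edges N a \<union> (\<lambda>i. \<beta> i k) ` {1..N}" by auto
    then show ?thesis using finite_edges by simp
  qed
  have neX: "?X k \<noteq> {}" for k using N by auto
  have z_in: "z k \<in> ?X k" for k unfolding z_def by (rule Min_in[OF finX neX])
  have z_le: "z k \<le> t" if "t \<in> ?X k" for k t unfolding z_def by (rule Min_le[OF finX that])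
  have "\<forall>q\<in>E. \<exists>c. \<forall>k\<ge>1. \<alpha> (fst q) (snd q) (k + 1) / \<alpha> (fst q) (snd q) k \<le> c" using step_i by auto
  from bchoice[OF this] obtain c1 where
    "\<forall>q\<in>E. \<forall>k\<ge>1. \<alpha> (fst q) (snd q) (k + 1) / \<alpha> (fst q) (snd q) k \<le> c1 q" ..
  then have c1: "\<alpha> i j (k + 1) / \<alpha> i j k \<le> c1 (i, j)" if "(i, j) \<in> E" "1 \<le> k" for i j k
    using that by fastforce
  have "\<forall>i\<in>V. \<exists>c. \<forall>k\<ge>1. \<beta> i (k + 1) / \<beta> i k \<le> c" using step_ii by auto
  from bchoice[OF this] obtain c2 where
    "\<forall>i\<in>V. \<forall>k\<ge>1. \<beta> i (k + 1) / \<beta> i k \<le> c2 i" ..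
  then have c2: "\<beta> i (k + 1) / \<beta> i k \<le> c2 i" if "i \<in> V" "1 \<le> k" for i k
    using that by blast
  \<comment> \<open>One constant above all ratio bounds: absolute values make each summand
    nonnegative, so that the sum dominates every single bound.\<close>
  define c where "c = 1 + (\<Sum>q\<in>E. \<bar>c1 q\<bar>) + (\<Sum>i\<in>V. \<bar>c2 i\<bar>)"
  have finE: "finite E" and finV: "finite V" unfolding E_def V_def using finite_edges by auto
  have c_ge: "1 \<le> c" unfolding c_def by (simp add: sum_nonneg add_nonneg_nonneg)
  have c1c: "c1 q \<le> c" if "q \<in> E" for q
    using member_le_sum[OF that _ finE, of "\<lambda>q. \<bar>c1 q\<bar>"] sum_nonneg[of V "\<lambda>i. \<bar>c2 i\<bar>"]
    unfolding c_def by (smt (verit) abs_ge_zero)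
  have c2c: "c2 i \<le> c" if "i \<in> V" for i
    using member_le_sum[OF that _ finV, of "\<lambda>q. \<bar>c2 q\<bar>"] sum_nonneg[of E "\<lambda>i. \<bar>c1 i\<bar>"]
    unfolding c_def by (smt (verit) abs_ge_zero)
  \<comment> \<open>The minimum is attained by one of the gains, and the same gain one step later
    bounds the next minimum. The power of the time index helps, since it stands in the denominator
    and does not decrease.\<close>
  have z_ratio: "z (Suc (Suc k)) \<le> c * z (Suc k)" for k
  proof -
    consider i j where "(i, j) \<in> E" "z (Suc k) = \<alpha> i j (Suc k) / real (Suc k) powr \<nu> i j"
      | i where "i \<in> V" "z (Suc k) = \<beta> i (Suc k)"
      using z_in[of "Suc k"] unfolding E_def V_def by blast
    then show ?thesis
    proof cases
      case 1
      have ap: "0 < \<alpha> i j (Suc k)" "0 < \<alpha> i j (Suc (Suc k))" using \<alpha>_pos[OF 1(1)] by auto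
      have "\<alpha> i j (Suc (Suc k)) / \<alpha> i j (Suc k) \<le> c"
        using c1[OF 1(1), of "Suc k"] c1c[OF 1(1)] by simp
      then have ac: "\<alpha> i j (Suc (Suc k)) \<le> c * \<alpha> i j (Suc k)" using ap by (simp add: divide_le_eq)
      have "z (Suc (Suc k)) \<le> \<alpha> i j (Suc (Suc k)) / real (Suc (Suc k)) powr \<nu> i j"
        by (rule z_le) (use 1 in \<open>auto simp: E_def\<close>)
      also have "\<dots> \<le> \<alpha> i j (Suc (Suc k)) / real (Suc k) powr \<nu> i j"
        using \<nu>_nonneg[OF 1(1)] ap by (intro divide_left_mono powr_mono2) auto
      also have "\<dots> \<le> c * \<alpha> i j (Suc k) / real (Suc k) powr \<nu> i j"
        using ac by (intro divide_right_mono) auto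
      finally show ?thesis unfolding 1(2) by simp
    next
      case 2
      have bp: "0 < \<beta> i (Suc k)" using \<beta>_pos[OF 2(1)] by auto
      have "z (Suc (Suc k)) \<le> \<beta> i (Suc (Suc k))" by (rule z_le) (use 2 in \<open>auto simp: V_def\<close>)
      also have "\<dots> \<le> c * \<beta> i (Suc k)"
        using c2[OF 2(1), of "Suc k"] c2c[OF 2(1)] bp by (simp add: divide_le_eq) (smt (verit) mult_right_mono)
      finally show ?thesis unfolding 2(2) .
    qed
  qed
  have z_nonneg: "0 \<le> z (Suc k)" for k
  proof -
    have "0 \<le> t" if "t \<in> ?X (Suc k)" for t
      using that \<alpha>_pos[unfolded E_def] \<beta>_pos[unfolded V_def] by (auto simp: less_imp_le)
    then show ?thesis using z_in by blast
  qed
  have z_not_summable: "\<not> summable (\<lambda>k. z (Suc k))"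
  proof
    assume "summable (\<lambda>k. z (Suc k))"
    then have "(\<lambda>K. \<Sum>k<K. z (Suc k)) \<longlonglongrightarrow> (\<Sum>k. z (Suc k))" by (rule summable_LIMSEQ)
    moreover have "(\<Sum>k<K. z (Suc k)) = (\<Sum>k=1..K. z k)" for K
      by (rule sum.reindex_bij_witness[of _ "\<lambda>k. k - 1" Suc]) auto
    ultimately have "(\<lambda>K. \<Sum>k=1..K. z k) \<longlonglongrightarrow> (\<Sum>k. z (Suc k))" by simp
    moreover have "filterlim (\<lambda>K. \<Sum>k=1..K. z k) at_infinity sequentially"
      using step_iii by (rule filterlim_at_top_imp_at_infinity)
    ultimately show False using not_tendsto_and_filterlim_at_infinity[OF sequentially_bot] by blast
  qed
  have H: "H i k \<in> carrier_mat (m i) n" if "i \<in> {1..N}" "1 \<le> k" for i k using H_dim that unfolding iV by auto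
  \<comment> \<open>The average over \<open>p\<close> steps in the excitation condition becomes a
    plain sum, which turns its constant into \<open>real p * \<delta>\<close>.\<close>
  interpret sc_network n N m a \<nu> b \<alpha> \<beta> "\<lambda>i k r l. H i k $$ (r, l)" Hbar "real p * \<delta>" c p "\<lambda>k. z (Suc k)"
  proof
    show "\<bar>H i (Suc k) $$ (r, l)\<bar> \<le> Hbar" if "i \<in> {1..N}" "r < m i" "l < n" for i k r l
      by (rule mat_entry_le[OF H]) (use that A1_bound(2)[unfolded V_def] in auto)
    fix k and x :: "nat \<Rightarrow> real"
    have "\<delta> * (vec n x \<bullet> vec n x) \<le> (1 / real p) * (\<Sum>t\<in>{Suc k..Suc k+p-1}. \<Sum>i\<in>V. vec n x \<bullet> ((transpose_mat (H i t) * H i t) *\<^sub>v vec n x))"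
      by (rule A1_pe(3)) auto
    also have "(\<Sum>t\<in>{Suc k..Suc k+p-1}. \<Sum>i\<in>V. vec n x \<bullet> ((transpose_mat (H i t) * H i t) *\<^sub>v vec n x))
        = (\<Sum>t\<in>{Suc k..Suc k+p-1}. \<Sum>i\<in>{1..N}. \<Sum>r<m i. (\<Sum>l<n. H i t $$ (r, l) * x l)\<^sup>2)"
    proof (intro sum.cong)
      fix t i assume "t \<in> {Suc k..Suc k+p-1}" "i \<in> {1..N}"
      then show "vec n x \<bullet> ((transpose_mat (H i t) * H i t) *\<^sub>v vec n x) = (\<Sum>r<m i. (\<Sum>l<n. H i t $$ (r, l) * x l)\<^sup>2)"
        by (subst gram_quadratic_form[OF H]) auto
    qed (auto simp: V_def)
    also have "\<dots> = (\<Sum>t<p. \<Sum>i\<in>{1..N}. \<Sum>r<m i. (\<Sum>l<n. H i (Suc (k + t)) $$ (r, l) * x l)\<^sup>2)"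
      by (rule sum.reindex_bij_witness[of _ "\<lambda>t. Suc (k + t)" "\<lambda>t. t - Suc k"]) (use A1_pe(1) in auto)
    finally show "real p * \<delta> * (\<Sum>l<n. (x l)\<^sup>2)
        \<le> (\<Sum>t<p. \<Sum>i\<in>{1..N}. \<Sum>r<m i. (\<Sum>l<n. H i (Suc (k + t)) $$ (r, l) * x l)\<^sup>2)"
      using A1_pe(1) by (simp add: scalar_prod_def atLeast0LessThan power2_eq_square field_simps)
  next
    show "summable (\<lambda>k. (\<alpha> i j (Suc k))\<^sup>2)" if "(i, j) \<in> edges N a" for i j
      using step_i[of i j] that unfolding E_def by (subst summable_Suc_iff) auto
    show "summable (\<lambda>k. (\<beta> i (Suc k))\<^sup>2)" if "i \<in> {1..N}" for i
      using step_ii[of i] that unfolding V_def by (subst summable_Suc_iff) auto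
    show "z (Suc k) \<le> \<alpha> i j (Suc k) / real (Suc k) powr \<nu> i j" if "(i, j) \<in> edges N a" for i j k
      by (rule z_le) (use that in auto)
    show "z (Suc k) \<le> \<beta> i (Suc k)" if "i \<in> {1..N}" for i k
      by (rule z_le) (use that in auto)
  qed (use n N a_sym A3 A1_pe \<nu>_sym b_sym \<alpha>_sym \<nu>_nonneg b_pos \<alpha>_pos \<beta>_pos z_nonneg z_ratio z_not_summable c_ge
      in \<open>auto simp: E_def V_def\<close>)
  define est where "est k i \<omega> = sc_est n N a \<nu> b \<alpha> \<beta> H \<theta>0 (\<lambda>j t. d j t \<omega>)
    (\<lambda>j t. H j t *\<^sub>v \<theta> + wvec j t \<omega>) k i" for k i \<omega>
  define e where "e k i l \<omega> = est k i \<omega> $ l - \<theta> $ l" for k i l \<omega>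
  obtain \<rho> where \<rho>: "2 < \<rho>" and bound: "AE \<omega> in M. (\<Squnion>i\<in>V. \<Squnion>k\<in>{1..}.
      nn_cond_exp M (Fw (k - 1)) (\<lambda>\<omega>'. ennreal (vnorm (wvec i k \<omega>') powr \<rho>)) \<omega>) < \<infinity>"
    using w_moment by blast
  have conv: "AE \<omega> in M. (\<lambda>k. nsq (\<lambda>i l. e k i l \<omega>)) \<longlonglongrightarrow> 0"
  proof (rule AE_nsq_tendsto_0[where F=F and G=Fw and \<theta>="\<lambda>l. \<theta> $ l" and d="\<lambda>k j. d j (Suc k)"
        and w="\<lambda>k i r. w i (Suc k) r" and f="\<lambda>k i \<omega>. ennreal (vnorm (wvec i (Suc k) \<omega>) powr \<rho>)"])
    fix k
    show "subalgebra M (F k)"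
      unfolding F_def using w_meas d_meas by (intro subalgebra_sigma_fun) (auto simp: V_def)
    show "subalgebra (F (Suc k)) (F k)"
      unfolding F_def by (rule subalgebra_sigma_fun_mono) (blast intro: le_SucI)
    show "subalgebra (F k) (Fw k)"
      unfolding F_def Fw_def by (rule subalgebra_sigma_fun_mono) (rule Un_upper1)
  next
    fix i l assume "i \<in> {1..N}" "l < n"
    then show "e 0 i l \<in> borel_measurable (F 0)" by (simp add: e_def[abs_def] est_def)
  next
    fix i l k \<omega> assume i: "i \<in> {1..N}" and l: "l < n"
    have theta0: "\<And>i. i \<in> {1..N} \<Longrightarrow> \<theta>0 i \<in> carrier_vec n" using theta0_dim by (simp add: V_def)
    have "est (Suc k) i \<omega> $ l = est k i \<omega> $ l
      + (if l = k mod n then \<Sum>j\<in>nbrs N a i. \<alpha> i j (Suc k) * a i j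
          * (recv \<nu> b j i (Suc k) (est k j \<omega> $ (k mod n)) (d j (Suc k) \<omega>)
            - Gfun \<nu> b i j (Suc k) (est k i \<omega> $ (k mod n))) else 0)
      + \<beta> i (Suc k) * (\<Sum>r<m i. H i (Suc k) $$ (r, l)
          * (w i (Suc k) r \<omega> - (\<Sum>u<n. H i (Suc k) $$ (r, u) * (est k i \<omega> $ u - \<theta> $ u))))"
      unfolding est_def wvec_def by (rule sc_est_Suc_index[OF n theta0 H theta_dim i l])
    then show "e (Suc k) i l \<omega> = e k i l \<omega>
      + (if l = k mod n then \<Sum>j\<in>nbrs N a i. \<alpha> i j (Suc k) * a i j
          * (recv \<nu> b j i (Suc k) (\<theta> $ (k mod n) + e k j (k mod n) \<omega>) (d j (Suc k) \<omega>)
            - Gfun \<nu> b i j (Suc k) (\<theta> $ (k mod n) + e k i (k mod n) \<omega>)) else 0)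
      + \<beta> i (Suc k) * (\<Sum>r<m i. H i (Suc k) $$ (r, l) * (w i (Suc k) r \<omega> - obs i k (\<lambda>l. e k i l \<omega>) r))"
      unfolding e_def obs_def by simp
  next
    fix k j assume j: "j \<in> {1..N}"
    then have "1 \<le> Suc k" "Suc k \<le> Suc k" by auto
    then show "d j (Suc k) \<in> borel_measurable (F (Suc k))"
      unfolding F_def using j by (intro measurable_sigma_fun UnI2) blast
    show "distributed M lborel (d j (Suc k)) (\<lambda>t. ennreal (exp (- \<bar>t\<bar>) / 2))"
      using d_lap j by (simp add: V_def)
    show "indep_set (sets (F k)) (sets (sigma_fun M {d j (Suc k)}))"
      unfolding F_def
    \<comment> \<open>The noise up to time \<open>k\<close> is part of \<open>Wall\<close>, whose
      joint independence with all dithers is the assumption.\<close>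
    proof (rule indep_past_dither[OF d_indep])
      show "j \<in> V" using j by (simp add: V_def)
    qed (unfold Wall_def V_def, blast)
  next
    fix k i r assume i: "i \<in> {1..N}" and r: "r < m i"
    have "1 \<le> Suc k" "Suc k \<le> Suc k" by auto
    then show "w i (Suc k) r \<in> borel_measurable (F (Suc k))"
      unfolding F_def using i r by (intro measurable_sigma_fun UnI1) blast
    show "integrable M (w i (Suc k) r)" using w_int i r by (simp add: V_def)
    show "AE \<omega> in M. real_cond_exp M (F k) (w i (Suc k) r) \<omega> = 0"
      using w_mds[of i "Suc k" r] i r by (simp add: V_def)
    show "ennreal ((w i (Suc k) r \<omega>)\<^sup>2) \<le> 1 + ennreal (vnorm (wvec i (Suc k) \<omega>) powr \<rho>)" for \<omega>
    proof -
      have "(w i (Suc k) r \<omega>)\<^sup>2 \<le> 1 + vnorm (wvec i (Suc k) \<omega>) powr \<rho>"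
        using vec_index_square_le_moment[of r "wvec i (Suc k) \<omega>" \<rho>] r \<rho> by (simp add: wvec_def)
      then have "ennreal ((w i (Suc k) r \<omega>)\<^sup>2) \<le> ennreal (1 + vnorm (wvec i (Suc k) \<omega>) powr \<rho>)"
        by (rule ennreal_leI)
      then show ?thesis by simp
    qed
  next
    fix k i assume "i \<in> {1..N}"
    then have [measurable]: "w i (Suc k) r \<in> borel_measurable M" if "r < m i" for r
      using w_meas that by (simp add: V_def)
    have "(\<lambda>\<omega>. \<Sum>r<m i. (w i (Suc k) r \<omega>)\<^sup>2) \<in> borel_measurable M"
      by (intro borel_measurable_sum borel_measurable_power) simp
    then show "(\<lambda>\<omega>. ennreal (vnorm (wvec i (Suc k) \<omega>) powr \<rho>)) \<in> borel_measurable M"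
      unfolding vnorm_eq wvec_def by simp
  next
    fix i assume i: "i \<in> {1..N}"
    show "AE \<omega> in M. (\<Squnion>k. nn_cond_exp M (Fw k) (\<lambda>\<omega>'. ennreal (vnorm (wvec i (Suc k) \<omega>') powr \<rho>)) \<omega>) < \<infinity>"
      using bound
    proof eventually_elim
      case (elim \<omega>)
      let ?g = "\<lambda>i k. nn_cond_exp M (Fw (k - 1)) (\<lambda>\<omega>'. ennreal (vnorm (wvec i k \<omega>') powr \<rho>)) \<omega>"
      have "(\<Squnion>k. nn_cond_exp M (Fw k) (\<lambda>\<omega>'. ennreal (vnorm (wvec i (Suc k) \<omega>') powr \<rho>)) \<omega>) = (\<Squnion>k. ?g i (Suc k))"
        by simp
      also have "\<dots> \<le> (\<Squnion>k\<in>{1..}. ?g i k)" by (intro SUP_least SUP_upper) simp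
      also have "\<dots> \<le> (\<Squnion>i\<in>V. \<Squnion>k\<in>{1..}. ?g i k)" using i by (intro SUP_upper) (simp add: V_def)
      finally show ?case using elim by (rule le_less_trans)
    qed
  qed (rule prob)
  show ?thesis
  proof
    fix i assume "i \<in> V"
    then have i: "i \<in> {1..N}" by (simp add: V_def)
    show "AE \<omega> in M. (\<lambda>k. vnorm (sc_est n N a \<nu> b \<alpha> \<beta> H \<theta>0 (\<lambda>j t. d j t \<omega>)
        (\<lambda>j t. H j t *\<^sub>v \<theta> + wvec j t \<omega>) k i - \<theta>)) \<longlonglongrightarrow> 0"
      using conv
    proof eventually_elim
      case (elim \<omega>)
      have "vnorm (est k i \<omega> - \<theta>) = sqrt (\<Sum>l<n. (e k i l \<omega>)\<^sup>2)" for k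
        unfolding vnorm_eq e_def using theta_dim by simp
      then have le: "vnorm (est k i \<omega> - \<theta>) \<le> sqrt (nsq (\<lambda>i l. e k i l \<omega>))" for k
        using sum_square_le_nsq[OF i, of "\<lambda>i l. e k i l \<omega>"] by simp
      have "(\<lambda>k. sqrt (nsq (\<lambda>i l. e k i l \<omega>))) \<longlonglongrightarrow> sqrt 0" using elim by (rule tendsto_real_sqrt)
      then have "(\<lambda>k. sqrt (nsq (\<lambda>i l. e k i l \<omega>))) \<longlonglongrightarrow> 0" by simp
      then have "(\<lambda>k. vnorm (est k i \<omega> - \<theta>)) \<longlonglongrightarrow> 0"
        by (rule tendsto_sandwich[OF _ _ tendsto_const, rotated 2])
          (use le in \<open>auto simp: vnorm_eq intro!: always_eventually sum_nonneg\<close>)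
      then show ?case unfolding est_def .
    qed
  qed
qed

end
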